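(* For any $\rho>0$ there are constants $\beta>0$, $C\ge0$ such that for every distribution $D$ over $\mathbb{R}^d\times\{\pm1\}$ with $D_X\in\mathcal{D}_\rho$, every $\gamma>0$ and every $\epsilon<\frac12-\ell^*_\gamma(D)$, \[ m(\epsilon,\gamma,D,1/4)\ge\beta\,k_\gamma(D_X)-C. \]
   Context: Hypothesis class $\mathcal{W}=\{x\mapsto\langle w,x\rangle\mid\|w\|\le1\}$. For $h$: $\ell_0(h,D)=\mathbb{P}_{(X,Y)\sim D}[Yh(X)\le0]$, $\ell_\gamma(h,D)=\mathbb{P}[Yh(X)\le\gamma]$, $\ell^*_\gamma(D)=\inf_{h\in\mathcal{W}}\ell_\gamma(h,D)$; for a labeled sample $S$ of size $n$, $\ell_\gamma(h,S)=\frac1n|\{i:y_ih(x_i)\le\gamma\}|$. A learning algorithm maps finite labeled samples to functions; $\ell_0(\mathcal{A},D,n,\delta)=\inf\{\epsilon\ge0\mid\mathbb{P}_{S\sim D^n}[\ell_0(\mathcal{A}(S),D)\ge\epsilon]\le\delta\}$. An MEM algorithm $\mathcal{A}$ maps each $\gamma>0$ to $\mathcal{A}_\gamma$ with $\mathcal{A}_\gamma(S)\in\arg\min_{h\in\mathcal{W}}\ell_\gamma(h,S)$. The sample complexity $m(\epsilon,\gamma,D,\delta)$ is the minimal $m_0$ such that for every MEM algorithm and every $n\ge m_0$, $\ell_0(\mathcal{A}_\gamma,D,n,\delta)-\ell^*_\gamma(D)\le\epsilon$. $D_X$ is $(b,k)$-limited if there is a subspace $V$ of dimension $d-k$ with $\mathbb{E}_{X\sim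 D_X}[\|O_VX\|^2]\le b$ ($O_V$ the orthogonal projection onto $V$); $k_\gamma(D_X)$ is the minimal $k$ with $D_X$ $(\gamma^2k,k)$-limited, equivalently $\min\{k\mid\sum_{i>k}\lambda_i\le\gamma^2k\}$ for the eigenvalues $\lambda_1\ge\dots\ge\lambda_d$ of $\mathbb{E}[XX^T]$. A real random variable $Z$ is sub-Gaussian with relative moment $\rho$ if $\mathbb{E}[\exp(tZ)]\le\exp(t^2\rho^2\mathbb{E}[Z^2]/2)$ for all $t$. $\mathcal{D}_\rho$ is the family of distributions $D_X$ (any dimension) for which some orthonormal basis $a_1,\dots,a_d$ makes $\langle a_i,X\rangle$, $X\sim D_X$, independent and each sub-Gaussian with relative moment $\rho$. *)

theory Defs
  imports "HOL-Probability.Probability"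
begin

text \<open>Points of R^d are represented as functions nat \<Rightarrow> real, only the
  coordinates below d being relevant; labels are reals in {-1,1}.\<close>

definition inner_d :: "nat \<Rightarrow> (nat \<Rightarrow> real) \<Rightarrow> (nat \<Rightarrow> real) \<Rightarrow> real" where
  "inner_d d w x = (\<Sum>i<d. w i * x i)"

definition W_d :: "nat \<Rightarrow> (nat \<Rightarrow> real) set" where
  "W_d d = {w. (\<Sum>i<d. (w i)\<^sup>2) \<le> 1}"

definition space_X :: "nat \<Rightarrow> (nat \<Rightarrow> real) measure" where
  "space_X d = PiM {..<d} (\<lambda>_. borel)"

definition labels :: "real measure" where
  "labels = count_space {-1, 1}"

definition marginal :: "nat \<Rightarrow> ((nat \<Rightarrow> real) \<times> real) measure \<Rightarrow> (nat \<Rightarrow> real) measure" where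
  "marginal d D = distr D (space_X d) fst"

definition loss0 :: "nat \<Rightarrow> ((nat \<Rightarrow> real) \<times> real) measure \<Rightarrow> (nat \<Rightarrow> real) \<Rightarrow> real" where
  "loss0 d D w = measure D {p \<in> space D. snd p * inner_d d w (fst p) \<le> 0}"

definition loss_margin :: "nat \<Rightarrow> real \<Rightarrow> ((nat \<Rightarrow> real) \<times> real) measure \<Rightarrow> (nat \<Rightarrow> real) \<Rightarrow> real" where
  "loss_margin d \<gamma> D w = measure D {p \<in> space D. snd p * inner_d d w (fst p) \<le> \<gamma>}"

definition opt_margin_loss :: "nat \<Rightarrow> real \<Rightarrow> ((nat \<Rightarrow> real) \<times> real) measure \<Rightarrow> real" where
  "opt_margin_loss d \<gamma> D = (INF w\<in>W_d d. loss_margin d \<gamma> D w)"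

definition emp_margin_loss :: "nat \<Rightarrow> real \<Rightarrow> (nat \<Rightarrow> real) \<Rightarrow> nat \<Rightarrow> (nat \<Rightarrow> (nat \<Rightarrow> real) \<times> real) \<Rightarrow> real" where
  "emp_margin_loss d \<gamma> w n S =
     real (card {i\<in>{..<n}. snd (S i) * inner_d d w (fst (S i)) \<le> \<gamma>}) / real n"

text \<open>A learning algorithm maps (n, sample of size n) to a predictor (given by its weight vector,
  since MEM outputs lie in W). An MEM algorithm is a family indexed by gamma.\<close>
type_synonym alg = "nat \<Rightarrow> (nat \<Rightarrow> (nat \<Rightarrow> real) \<times> real) \<Rightarrow> (nat \<Rightarrow> real)"

definition is_MEM :: "nat \<Rightarrow> (real \<Rightarrow> alg) \<Rightarrow> bool" where
  "is_MEM d A \<longleftrightarrow> (\<forall>\<gamma>>0. \<forall>n S. A \<gamma> n S \<in> W_d d \<and>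
      (\<forall>w\<in>W_d d. emp_margin_loss d \<gamma> (A \<gamma> n S) n S \<le> emp_margin_loss d \<gamma> w n S))"

definition learn_loss :: "nat \<Rightarrow> ((nat \<Rightarrow> real) \<times> real) measure \<Rightarrow> alg \<Rightarrow> nat \<Rightarrow> real \<Rightarrow> real" where
  "learn_loss d D A n \<delta> = Inf {\<epsilon>. \<epsilon> \<ge> 0 \<and>
      measure (PiM {..<n} (\<lambda>_. D))
        {S \<in> space (PiM {..<n} (\<lambda>_. D)). loss0 d D (A n S) \<ge> \<epsilon>} \<le> \<delta>}"

text \<open>Sample complexity m(eps,gamma,D,delta); infinity if no m_0 works.\<close>
definition sample_complexity :: "nat \<Rightarrow> real \<Rightarrow> real \<Rightarrow> ((nat \<Rightarrow> real) \<times> real) measure \<Rightarrow> real \<Rightarrow> enat" where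
  "sample_complexity d \<epsilon> \<gamma> D \<delta> = Inf {enat m0 | m0. \<forall>A. is_MEM d A \<longrightarrow>
      (\<forall>n\<ge>m0. learn_loss d D (A \<gamma>) n \<delta> - opt_margin_loss d \<gamma> D \<le> \<epsilon>)}"

text \<open>(b,k)-limited: a subspace V of dimension d-k, given by an orthonormal basis v_0..v_{d-k-1},
  with E ||O_V X||^2 = E sum_j <v_j,X>^2 \<le> b.\<close>
definition limited :: "nat \<Rightarrow> (nat \<Rightarrow> real) measure \<Rightarrow> real \<Rightarrow> nat \<Rightarrow> bool" where
  "limited d DX b k \<longleftrightarrow> k \<le> d \<and> (\<exists>v :: nat \<Rightarrow> nat \<Rightarrow> real.
      (\<forall>i<d-k. \<forall>j<d-k. inner_d d (v i) (v j) = (if i = j then 1 else 0)) \<and>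
      (\<integral>\<^sup>+x. ennreal (\<Sum>j<d-k. (inner_d d (v j) x)\<^sup>2) \<partial>DX) \<le> ennreal b)"

definition k_gamma :: "nat \<Rightarrow> real \<Rightarrow> (nat \<Rightarrow> real) measure \<Rightarrow> nat" where
  "k_gamma d \<gamma> DX = (LEAST k. limited d DX (\<gamma>\<^sup>2 * real k) k)"

definition subgaussian_rel :: "'a measure \<Rightarrow> real \<Rightarrow> ('a \<Rightarrow> real) \<Rightarrow> bool" where
  "subgaussian_rel M \<rho> Z \<longleftrightarrow> Z \<in> borel_measurable M \<and> integrable M (\<lambda>x. (Z x)\<^sup>2) \<and>
     (\<forall>t::real. (\<integral>\<^sup>+x. ennreal (exp (t * Z x)) \<partial>M)
                 \<le> ennreal (exp (t\<^sup>2 * \<rho>\<^sup>2 * (\<integral>x. (Z x)\<^sup>2 \<partial>M) / 2)))"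

definition D_rho :: "real \<Rightarrow> nat \<Rightarrow> (nat \<Rightarrow> real) measure \<Rightarrow> bool" where
  "D_rho \<rho> d DX \<longleftrightarrow> (\<exists>a :: nat \<Rightarrow> nat \<Rightarrow> real.
      (\<forall>i<d. \<forall>j<d. inner_d d (a i) (a j) = (if i = j then 1 else 0)) \<and>
      prob_space.indep_vars DX (\<lambda>_. borel) (\<lambda>i x. inner_d d (a i) x) {..<d} \<and>
      (\<forall>i<d. subgaussian_rel DX \<rho> (\<lambda>x. inner_d d (a i) x)))"

end

(* A two-sample argument replaces no-free-lunch: if some w in the unit ball separates a sample of
   size 2n with margin > gamma, correctly on the first half and wrongly on the second half, then w
   has empirical margin loss 0 on the first half and -w on the second half.  As
   loss0 w + loss0 (-w) >= 1, one of the two halves admits a margin-error minimizer with true loss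
   at least 1/2, so an adversarial MEM algorithm fails with probability more than 1/4 as soon as
   the split is possible with probability more than 1/2.

   By minimality of k_gamma, suitably damping each coordinate of the independent basis turns the
   covariance into one with all eigenvalues <= gamma^2 and trace gamma^2 (k_gamma - 1).  The split
   exists if ||sum_i v_i x_i|| > gamma for all v on the l1-sphere.  For fixed v the damped squared
   norm is at least a constant fraction of its mean, up to probability exp(-c k_gamma).  The union
   bound over v runs over an l1-grid with at most C^n points; rounding v to the grid costs only a
   small multiple of the trace of the Gram matrix (controlled by Markov's inequality), so no bound
   on its operator norm is needed. *)

theory Submission
  imports Defs
begin

section \<open>Geometry of finite point sets\<close>

text \<open>The direction is a point \<open>p\<close> of nearly minimal norm in the convex hull of
  the \<open>z i\<close>: a short move from \<open>p\<close> towards \<open>z i\<close> cannot lower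
  the squared norm by more than the tolerance, which keeps the inner product of \<open>p\<close> and
  \<open>z i\<close> near the squared norm of \<open>p\<close>. The gap between
  \<open>\<gamma>\<close> and \<open>c\<close> absorbs the error of an approximate
  minimizer.\<close>

lemma minimal_point_separation:
  fixes z :: "nat \<Rightarrow> nat \<Rightarrow> real" and c \<gamma> :: real and m d :: nat
  assumes "0 < \<gamma>" "\<gamma> < c"
    and far: "\<And>v. (\<And>i. i < m \<Longrightarrow> 0 \<le> v i) \<Longrightarrow> (\<Sum>i<m. v i) = 1 \<Longrightarrow>
               c\<^sup>2 \<le> (\<Sum>j<d. (\<Sum>i<m. v i * z i j)\<^sup>2)"
  shows "\<exists>\<omega>. (\<Sum>j<d. (\<omega> j)\<^sup>2) \<le> 1 \<and> (\<forall>i<m. \<gamma> < (\<Sum>j<d. \<omega> j * z i j))"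
proof (cases "m = 0")
  case True
  then show ?thesis by (intro exI[of _ "\<lambda>_. 0"]) simp
next
  case False
  then have "0 < m" by simp
  define \<Delta> where "\<Delta> = {v :: nat \<Rightarrow> real. (\<forall>i<m. 0 \<le> v i) \<and> (\<Sum>i<m. v i) = 1}"
  define q where "q v = (\<Sum>j<d. (\<Sum>i<m. v i * z i j)\<^sup>2)" for v :: "nat \<Rightarrow> real"
  have q_ge: "c\<^sup>2 \<le> q v" if "v \<in> \<Delta>" for v
    using that far[of v] by (auto simp: \<Delta>_def q_def)
  have \<delta>: "(\<lambda>l. if l = i then 1 else 0) \<in> \<Delta>" if "i < m" for i
    using that by (auto simp: \<Delta>_def)
  have ne: "q ` \<Delta> \<noteq> {}" using \<delta>[OF \<open>0 < m\<close>] by blast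
  define I where "I = Inf (q ` \<Delta>)"
  have bdd: "bdd_below (q ` \<Delta>)" using q_ge by (intro bdd_belowI2[of _ "c\<^sup>2"])
  have I_le: "I \<le> q v" if "v \<in> \<Delta>" for v
    unfolding I_def using that bdd by (intro cInf_lower) auto
  have "c\<^sup>2 \<le> I" unfolding I_def using ne q_ge by (intro cInf_greatest) auto
  \<comment> \<open>\<open>K\<close> bounds the squared distance from the approximate minimizer to
    each \<open>z i\<close>, through |z - p|^2 <= 2|z|^2 + 2|p|^2 and |p|^2 <= I + 1.\<close>
  define K where "K = 2 * (\<Sum>i<m. \<Sum>j<d. (z i j)\<^sup>2) + 2 * (I + 1)"
  have "0 < I" using \<open>c\<^sup>2 \<le> I\<close> assms(1,2) by (smt (verit) zero_less_power)
  then have "0 < K" by (auto simp: K_def intro!: add_nonneg_pos sum_nonneg)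
  have "0 < c * (c - \<gamma>)" using assms(1,2) by simp
  \<comment> \<open>\<open>t\<close> is the step length and t^2 the tolerance of the minimizer.
    Comparing norms before and after a step costs t^2 (1 + K) in all; after division by
    \<open>t\<close> this may be at most c (c - \<gamma>).\<close>
  define t where "t = min 1 (c * (c - \<gamma>) / (1 + K))"
  have "0 < t" "t \<le> 1" using \<open>0 < c * (c - \<gamma>)\<close> \<open>0 < K\<close> by (auto simp: t_def)
  have tK: "t * (1 + K) \<le> c * (c - \<gamma>)"
    using \<open>0 < K\<close> mult_right_mono[of t "c * (c - \<gamma>) / (1 + K)" "1 + K"] by (simp add: t_def)
  have "I < I + t\<^sup>2" using \<open>0 < t\<close> by simp
  then obtain u where u: "u \<in> \<Delta>" "q u < I + t\<^sup>2"
    using cInf_lessD[OF ne] unfolding I_def by blast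
  define p where "p j = (\<Sum>i<m. u i * z i j)" for j
  define N where "N = (\<Sum>j<d. (p j)\<^sup>2)"
  have qu: "q u = N" by (simp add: q_def N_def p_def)
  have "c\<^sup>2 \<le> N" using q_ge[OF u(1)] qu by simp
  have "t\<^sup>2 \<le> 1" using \<open>0 < t\<close> \<open>t \<le> 1\<close> by (simp add: power_le_one)
  then have "N \<le> I + 1" using u(2) qu by simp
  define s where "s = sqrt N"
  have "c \<le> s" unfolding s_def using \<open>c\<^sup>2 \<le> N\<close> by (rule real_le_rsqrt)
  then have "0 < s" "\<gamma> < s" using assms by auto
  have s2: "s\<^sup>2 = N" unfolding s_def using \<open>c\<^sup>2 \<le> N\<close> by (smt (verit) real_sqrt_pow2 zero_le_power2)
  have inner_gt: "\<gamma> * s < (\<Sum>j<d. p j * z i j)" if "i < m" for i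
  proof -
    \<comment> \<open>Moving from \<open>u\<close> towards vertex \<open>i\<close> by the fraction
      \<open>t\<close> stays in the simplex, so the value there is at least
      \<open>I\<close>.\<close>
    let ?v = "\<lambda>l. u l + t * ((if l = i then 1 else 0) - u l)"
    have "?v l = (1 - t) * u l + t * (if l = i then 1 else 0)" for l
      by (simp add: algebra_simps)
    then have "?v \<in> \<Delta>"
      using u(1) \<open>i < m\<close> \<open>0 < t\<close> \<open>t \<le> 1\<close>
      by (auto simp: \<Delta>_def sum.distrib sum_subtractf sum_distrib_left[symmetric] simp del: sum_distrib_left)
    have "q ?v = (\<Sum>j<d. (p j + t * (z i j - p j))\<^sup>2)"
    proof -
      have "(\<Sum>l<m. ?v l * z l j) = p j + t * (z i j - p j)" for j
      proof -
        have "(\<Sum>l<m. ?v l * z l j) = (\<Sum>l<m. u l * z l j + t * ((if l = i then z l j else 0) - u l * z l j))"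
          by (intro sum.cong) (auto simp: algebra_simps)
        also have "\<dots> = p j + t * ((\<Sum>l<m. if l = i then z l j else 0) - p j)"
          unfolding p_def sum.distrib sum_subtractf sum_distrib_left[symmetric] ..
        finally show ?thesis using \<open>i < m\<close> by simp
      qed
      then show ?thesis by (simp add: q_def)
    qed
    also have "\<dots> = N + 2 * t * ((\<Sum>j<d. p j * z i j) - N) + t\<^sup>2 * (\<Sum>j<d. (z i j - p j)\<^sup>2)"
      unfolding N_def sum_subtractf[symmetric] sum_distrib_left sum.distrib[symmetric]
      by (intro sum.cong refl) (simp add: power2_eq_square algebra_simps)
    finally have q: "q ?v = N + 2 * t * ((\<Sum>j<d. p j * z i j) - N) + t\<^sup>2 * (\<Sum>j<d. (z i j - p j)\<^sup>2)" .
    have "(\<Sum>j<d. (z i j - p j)\<^sup>2) \<le> (\<Sum>j<d. 2 * (z i j)\<^sup>2 + 2 * (p j)\<^sup>2)"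
    proof (intro sum_mono)
      fix j show "(z i j - p j)\<^sup>2 \<le> 2 * (z i j)\<^sup>2 + 2 * (p j)\<^sup>2"
        using zero_le_power2[of "z i j + p j"] by (simp add: power2_eq_square algebra_simps)
    qed
    also have "\<dots> = 2 * (\<Sum>j<d. (z i j)\<^sup>2) + 2 * N"
      by (simp add: sum.distrib sum_distrib_left N_def)
    also have "(\<Sum>j<d. (z i j)\<^sup>2) \<le> (\<Sum>i<m. \<Sum>j<d. (z i j)\<^sup>2)"
      using \<open>i < m\<close> by (intro member_le_sum[of i "{..<m}" "\<lambda>i. \<Sum>j<d. (z i j)\<^sup>2"]) (auto intro: sum_nonneg)
    finally have "(\<Sum>j<d. (z i j - p j)\<^sup>2) \<le> K" using \<open>N \<le> I + 1\<close> by (simp add: K_def)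
    then have "t\<^sup>2 * (\<Sum>j<d. (z i j - p j)\<^sup>2) \<le> t\<^sup>2 * K" by (intro mult_left_mono) auto
    with q I_le[OF \<open>?v \<in> \<Delta>\<close>] u(2) qu
    have "0 < 2 * t * ((\<Sum>j<d. p j * z i j) - N) + t\<^sup>2 * (1 + K)" by (simp add: algebra_simps)
    then have "0 < t * (2 * ((\<Sum>j<d. p j * z i j) - N) + t * (1 + K))"
      by (simp add: power2_eq_square algebra_simps)
    then have *: "0 < 2 * ((\<Sum>j<d. p j * z i j) - N) + t * (1 + K)"
      using \<open>0 < t\<close> zero_less_mult_pos by blast
    have "c * (c - \<gamma>) \<le> s * (s - \<gamma>)"
      using \<open>c \<le> s\<close> assms by (intro mult_mono) auto
    then have "c * (c - \<gamma>) \<le> N - \<gamma> * s" by (simp add: s2[symmetric] power2_eq_square algebra_simps)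
    moreover have "y < x" if "e \<le> N - y" "0 < 2 * (x - N) + f" "f \<le> e" "0 < e" for x y e f :: real
      using that by (simp add: algebra_simps)
    ultimately show ?thesis using * tK \<open>0 < c * (c - \<gamma>)\<close> by blast
  qed
  show ?thesis
  proof (intro exI[of _ "\<lambda>j. p j / s"] conjI allI impI)
    have "(\<Sum>j<d. (p j / s)\<^sup>2) = N / s\<^sup>2" by (simp add: power_divide N_def sum_divide_distrib)
    then show "(\<Sum>j<d. (p j / s)\<^sup>2) \<le> 1" using s2 \<open>0 < s\<close> by simp
    fix i assume "i < m"
    have "(\<Sum>j<d. p j / s * z i j) = (\<Sum>j<d. p j * z i j) / s" by (simp add: sum_divide_distrib)
    moreover have "\<gamma> < (\<Sum>j<d. p j * z i j) / s"
      using inner_gt[OF \<open>i < m\<close>] \<open>0 < s\<close> by (simp add: pos_less_divide_eq)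
    ultimately show "\<gamma> < (\<Sum>j<d. p j / s * z i j)" by simp
  qed
qed

section \<open>Rounding vectors to a grid\<close>

lemma round_one_coordinate:
  fixes b z :: "nat \<Rightarrow> real" and v h :: real and d :: nat
  assumes "0 < h"
  shows "\<exists>k::int. \<bar>v - h * of_int k\<bar> \<le> h \<and>
    (\<Sum>j<d. (b j + h * of_int k * z j)\<^sup>2) \<le> (\<Sum>j<d. (b j + v * z j)\<^sup>2) + h\<^sup>2 / 4 * (\<Sum>j<d. (z j)\<^sup>2)"
proof -
  define l where "l = \<lfloor>v / h\<rfloor>"
  define a where "a = v / h - of_int l"
  have a: "0 \<le> a" "a \<le> 1" unfolding a_def l_def by linarith+
  have v: "v = h * (of_int l + a)" using assms by (simp add: a_def)
  let ?f = "\<lambda>t. (\<Sum>j<d. (b j + t * z j)\<^sup>2)"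
  \<comment> \<open>The grid neighbours of \<open>v\<close>, weighted by 1 - a and a, average to
    \<open>v\<close>; the average of the quadratic exceeds its value at \<open>v\<close> by the
    variance a (1 - a) h^2 times the squared norm of \<open>z\<close>. One neighbour is no worse
    than this average.\<close>
  have "(1 - a) * ?f (h * of_int l) + a * ?f (h * of_int (l + 1))
      = ?f v + (a * (1 - a) * h\<^sup>2) * (\<Sum>j<d. (z j)\<^sup>2)"
  proof -
    have "(1 - a) * B\<^sup>2 + a * (B + h * y)\<^sup>2 = (B + a * (h * y))\<^sup>2 + a * (1 - a) * h\<^sup>2 * y\<^sup>2" for B y
      by (simp add: power2_eq_square algebra_simps)
    from this[of "b j + h * of_int l * z j" "z j" for j]
    show ?thesis
      unfolding sum_distrib_left sum.distrib[symmetric] v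
      by (intro sum.cong refl) (simp add: algebra_simps)
  qed
  moreover have "a * (1 - a) * h\<^sup>2 * (\<Sum>j<d. (z j)\<^sup>2) \<le> h\<^sup>2 / 4 * (\<Sum>j<d. (z j)\<^sup>2)"
  proof (intro mult_right_mono sum_nonneg)
    have "a * (1 - a) \<le> 1 / 4"
      using zero_le_power2[of "a - 1/2"] by (simp add: power2_eq_square algebra_simps)
    then show "a * (1 - a) * h\<^sup>2 \<le> h\<^sup>2 / 4"
      using mult_right_mono[of "a * (1 - a)" "1/4" "h\<^sup>2"] by simp
  qed simp
  ultimately have le: "(1 - a) * ?f (h * of_int l) + a * ?f (h * of_int (l + 1))
      \<le> ?f v + h\<^sup>2 / 4 * (\<Sum>j<d. (z j)\<^sup>2)"
    by linarith
  have near: "?f (h * of_int l) \<le> ?f v + h\<^sup>2 / 4 * (\<Sum>j<d. (z j)\<^sup>2) \<or>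
        ?f (h * of_int (l + 1)) \<le> ?f v + h\<^sup>2 / 4 * (\<Sum>j<d. (z j)\<^sup>2)"
  proof (rule ccontr)
    assume "\<not> ?thesis"
    then have "?f v + h\<^sup>2 / 4 * (\<Sum>j<d. (z j)\<^sup>2) < ?f (h * of_int l)"
      "?f v + h\<^sup>2 / 4 * (\<Sum>j<d. (z j)\<^sup>2) < ?f (h * of_int (l + 1))" by auto
    then have "?f v + h\<^sup>2 / 4 * (\<Sum>j<d. (z j)\<^sup>2)
      < (1 - a) * ?f (h * of_int l) + a * ?f (h * of_int (l + 1))"
      using a convex_bound_lt[of "- ?f (h * of_int l)" "- (?f v + h\<^sup>2 / 4 * (\<Sum>j<d. (z j)\<^sup>2))"
          "- ?f (h * of_int (l + 1))" "1 - a" a] by linarith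
    with le show False by linarith
  qed
  have "0 \<le> h * a" "h * a \<le> h" using a assms by (simp_all add: mult_left_le)
  have "\<bar>v - h * of_int l\<bar> \<le> h" "\<bar>v - h * of_int (l + 1)\<bar> \<le> h"
  proof -
    have "v - h * of_int l = h * a" "v - h * of_int (l + 1) = h * a - h"
      by (simp_all add: v algebra_simps)
    then show "\<bar>v - h * of_int l\<bar> \<le> h" "\<bar>v - h * of_int (l + 1)\<bar> \<le> h"
      using \<open>0 \<le> h * a\<close> \<open>h * a \<le> h\<close> by linarith+
  qed
  with near show ?thesis by (elim disjE) (rule exI, erule conjI[rotated], assumption)+
qed

text \<open>Rounding at random and unbiasedly to the grid would increase the expected value of the
  quadratic form by at most the stated amount; choosing the better neighbour in one coordinate
  after the other derandomizes this.\<close>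

lemma round_to_grid:
  fixes z :: "nat \<Rightarrow> nat \<Rightarrow> real" and b v :: "nat \<Rightarrow> real" and h :: real and d m :: nat
  assumes "0 < h"
  shows "\<exists>k::nat \<Rightarrow> int. (\<forall>i<m. \<bar>v i - h * of_int (k i)\<bar> \<le> h) \<and>
    (\<Sum>j<d. (b j + (\<Sum>i<m. h * of_int (k i) * z i j))\<^sup>2)
      \<le> (\<Sum>j<d. (b j + (\<Sum>i<m. v i * z i j))\<^sup>2) + h\<^sup>2 / 4 * (\<Sum>i<m. \<Sum>j<d. (z i j)\<^sup>2)"
\<comment> \<open>The offset \<open>b\<close> is general so that it can carry the unrounded last
  coordinate while the others are rounded.\<close>
proof (induction m arbitrary: b)
  case 0
  then show ?case by simp
next
  case (Suc m)
  obtain k where k: "\<And>i. i < m \<Longrightarrow> \<bar>v i - h * of_int (k i)\<bar> \<le> h"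
    "(\<Sum>j<d. (b j + v m * z m j + (\<Sum>i<m. h * of_int (k i) * z i j))\<^sup>2)
      \<le> (\<Sum>j<d. (b j + v m * z m j + (\<Sum>i<m. v i * z i j))\<^sup>2) + h\<^sup>2 / 4 * (\<Sum>i<m. \<Sum>j<d. (z i j)\<^sup>2)"
    using Suc[of "\<lambda>j. b j + v m * z m j"] by blast
  obtain l :: int where l: "\<bar>v m - h * of_int l\<bar> \<le> h"
    "(\<Sum>j<d. ((b j + (\<Sum>i<m. h * of_int (k i) * z i j)) + h * of_int l * z m j)\<^sup>2)
      \<le> (\<Sum>j<d. ((b j + (\<Sum>i<m. h * of_int (k i) * z i j)) + v m * z m j)\<^sup>2) + h\<^sup>2 / 4 * (\<Sum>j<d. (z m j)\<^sup>2)"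
    using round_one_coordinate[OF assms, of "v m" "\<lambda>j. b j + (\<Sum>i<m. h * of_int (k i) * z i j)" "z m" d]
    by blast
  let ?k = "k(m := l)"
  have "\<forall>i<Suc m. \<bar>v i - h * of_int (?k i)\<bar> \<le> h"
    using k(1) l(1) by (auto simp: less_Suc_eq)
  moreover have "(\<Sum>i<Suc m. h * of_int (?k i) * z i j)
      = (\<Sum>i<m. h * of_int (k i) * z i j) + h * of_int l * z m j" for j
    by simp
  ultimately show ?case
    using k(2) l(2) by (intro exI[of _ ?k]) (simp add: algebra_simps)
qed

section \<open>Counting the points of an l1-grid\<close>

lemma sum_half_powers_int: "(\<Sum>z\<in>{- int L..int L}. (1/2::real) ^ nat \<bar>z\<bar>) = 3 - 2 * (1/2) ^ L"
proof (induction L)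
  case 0
  then show ?case by simp
next
  case (Suc L)
  have "{- int (Suc L)..int (Suc L)} = insert (- int (Suc L)) (insert (int (Suc L)) {- int L..int L})"
    by auto
  then have "(\<Sum>z\<in>{- int (Suc L)..int (Suc L)}. (1/2::real) ^ nat \<bar>z\<bar>)
      = 2 * (1/2) ^ Suc L + (\<Sum>z\<in>{- int L..int L}. (1/2) ^ nat \<bar>z\<bar>)"
    by (simp del: of_nat_Suc power_Suc)
  then show ?case using Suc by simp
qed

text \<open>Scaled by 1/8, these integer vectors form the net of the union bound. Fixing the values
  outside \<open>{..<m}\<close> makes the set finite.\<close>

definition l1_grid :: "nat \<Rightarrow> nat \<Rightarrow> (nat \<Rightarrow> int) set" where
  "l1_grid m s = {k \<in> {..<m} \<rightarrow>\<^sub>E {- int s..int s}. (\<Sum>i<m. \<bar>k i\<bar>) \<le> int s}"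

lemma finite_l1_grid: "finite (l1_grid m s)"
  unfolding l1_grid_def by (intro finite_subset[OF Collect_subset] finite_PiE) auto

text \<open>Give \<open>k\<close> the weight 2^(-|k|), with |k| its l1-norm. Each grid point weighs
  at least 2^(-s), while the total weight of the box factors over the coordinates, each factor being
  at most 3.\<close>

lemma card_l1_grid: "real (card (l1_grid m s)) \<le> 3 ^ m * 2 ^ s"
proof -
  let ?P = "{..<m} \<rightarrow>\<^sub>E {- int s..int s}"
  have "real (card (l1_grid m s)) * (1/2) ^ s = (\<Sum>k\<in>l1_grid m s. (1/2) ^ s)" by simp
  also have "\<dots> \<le> (\<Sum>k\<in>l1_grid m s. \<Prod>i<m. (1/2) ^ nat \<bar>k i\<bar>)"
  proof (intro sum_mono)
    fix k assume "k \<in> l1_grid m s"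
    then have "(\<Sum>i<m. nat \<bar>k i\<bar>) \<le> s"
      by (simp add: l1_grid_def nat_le_iff flip: of_nat_le_iff[where ?'a=int])
    then show "(1/2::real) ^ s \<le> (\<Prod>i<m. (1/2) ^ nat \<bar>k i\<bar>)"
      by (simp add: power_sum[symmetric] power_decreasing)
  qed
  also have "\<dots> \<le> (\<Sum>k\<in>?P. \<Prod>i<m. (1/2) ^ nat \<bar>k i\<bar>)"
  proof (rule sum_mono2)
    show "finite ?P" by (intro finite_PiE) auto
    show "l1_grid m s \<subseteq> ?P" unfolding l1_grid_def by (rule Collect_subset)
    show "0 \<le> (\<Prod>i<m. (1/2::real) ^ nat \<bar>k i\<bar>)" for k by (intro prod_nonneg) auto
  qed
  also have "\<dots> = (\<Prod>i<m. \<Sum>z\<in>{- int s..int s}. (1/2) ^ nat \<bar>z\<bar>)"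
    by (subst prod_sum_PiE) auto
  also have "\<dots> \<le> 3 ^ m"
  proof -
    have "0 \<le> (\<Sum>z\<in>{- int s..int s}. (1/2::real) ^ nat \<bar>z\<bar>)" by (intro sum_nonneg) auto
    moreover have "(\<Sum>z\<in>{- int s..int s}. (1/2::real) ^ nat \<bar>z\<bar>) \<le> 3"
      unfolding sum_half_powers_int by simp
    ultimately show ?thesis by (simp add: power_mono)
  qed
  finally have "real (card (l1_grid m s)) * (1/2) ^ s * 2 ^ s \<le> 3 ^ m * 2 ^ s"
    by (intro mult_right_mono) auto
  then show ?thesis by (simp add: mult.assoc flip: power_mult_distrib)
qed

section \<open>Sub-Gaussian random matrices\<close>

lemma pow4_le_exp: "(x::real) ^ 4 \<le> 64 * (exp x + exp (- x))"
proof -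
  have pos: "y ^ 4 \<le> 64 * exp y" if "0 \<le> y" for y :: real
  proof -
    have "1 + y / 2 + (y / 2)\<^sup>2 / 2 \<le> exp (y / 2)"
      using that by (intro exp_lower_Taylor_quadratic) simp
    then have "y\<^sup>2 / 8 \<le> exp (y / 2)" using that by (simp add: power_divide)
    then have "(y\<^sup>2 / 8)\<^sup>2 \<le> (exp (y / 2))\<^sup>2" by (intro power_mono) auto
    also have "(exp (y / 2))\<^sup>2 = exp y" by (simp flip: exp_double)
    finally show ?thesis by (simp add: power_divide)
  qed
  show ?thesis
  proof (cases "0 \<le> x")
    case True
    then show ?thesis using pos[of x] by (simp add: add_increasing2 distrib_left)
  next
    case False
    then show ?thesis using pos[of "- x"] by (simp add: add_increasing distrib_left)
  qed
qed

text \<open>The quadratics 1 + y + y^2/2 and 1 - y + y^2/2 multiply to 1 + y^4/4, so the lower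
  Taylor bound for exp y inverts to an upper bound for exp (- y).\<close>

lemma exp_minus_le_quadratic: "exp (- y) \<le> 1 - y + y\<^sup>2 / 2" if "0 \<le> (y::real)"
proof -
  have pos: "0 < 1 - y + y\<^sup>2 / 2"
    using zero_le_power2[of "y - 1"] by (simp add: power2_eq_square algebra_simps)
  have "1 \<le> 1 + (y\<^sup>2 / 2)\<^sup>2" by simp
  also have "\<dots> = (1 + y + y\<^sup>2 / 2) * (1 - y + y\<^sup>2 / 2)" by (simp add: power2_eq_square field_simps)
  also have "\<dots> \<le> exp y * (1 - y + y\<^sup>2 / 2)"
    using exp_lower_Taylor_quadratic[OF that] pos by (intro mult_right_mono) auto
  finally show ?thesis by (simp add: exp_minus field_simps)
qed

section \<open>Sub-Gaussian variables, their sums and quadratic forms\<close>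

context prob_space
begin

lemma subgaussian_rel_exp:
  assumes "subgaussian_rel M \<rho> Z"
  shows "integrable M (\<lambda>x. exp (t * Z x))"
    and "expectation (\<lambda>x. exp (t * Z x)) \<le> exp (t\<^sup>2 * \<rho>\<^sup>2 * expectation (\<lambda>x. (Z x)\<^sup>2) / 2)"
proof -
  have [measurable]: "Z \<in> borel_measurable M" using assms by (simp add: subgaussian_rel_def)
  have le: "(\<integral>\<^sup>+x. ennreal (exp (t * Z x)) \<partial>M) \<le> ennreal (exp (t\<^sup>2 * \<rho>\<^sup>2 * expectation (\<lambda>x. (Z x)\<^sup>2) / 2))"
    using assms by (simp add: subgaussian_rel_def)
  show int: "integrable M (\<lambda>x. exp (t * Z x))"
    using le by (intro integrableI_nonneg) (auto simp: order_le_less_trans)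
  show "expectation (\<lambda>x. exp (t * Z x)) \<le> exp (t\<^sup>2 * \<rho>\<^sup>2 * expectation (\<lambda>x. (Z x)\<^sup>2) / 2)"
    using le by (subst (asm) nn_integral_eq_integral[OF int]) auto
qed

lemma subgaussian_rel_integrable:
  assumes "subgaussian_rel M \<rho> Z"
  shows "integrable M Z"
  using assms by (simp add: subgaussian_rel_def square_integrable_imp_integrable)

text \<open>The exponential moment bound has no linear term in \<open>t\<close>, whereas exp (t Z)
  has expectation at least 1 + t E[Z]; small \<open>t\<close> with the sign of the mean rule out a
  nonzero mean. Zero means later cancel the mixed terms in the second moment of a sum.\<close>

lemma subgaussian_rel_mean_zero:
  assumes "subgaussian_rel M \<rho> Z"
  shows "expectation Z = 0"
proof (rule ccontr)
  define \<mu> where "\<mu> = expectation Z"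
  define c where "c = \<rho>\<^sup>2 * expectation (\<lambda>x. (Z x)\<^sup>2) / 2"
  assume "expectation Z \<noteq> 0"
  then have "0 < \<mu>\<^sup>2" by (simp add: \<mu>_def)
  have "0 \<le> c" by (simp add: c_def)
  have lin: "1 + t * \<mu> \<le> exp (t\<^sup>2 * c)" for t
  proof -
    have "1 + t * \<mu> = expectation (\<lambda>x. 1 + t * Z x)"
      using subgaussian_rel_integrable[OF assms] by (simp add: \<mu>_def prob_space)
    also have "\<dots> \<le> expectation (\<lambda>x. exp (t * Z x))"
      using subgaussian_rel_integrable[OF assms] subgaussian_rel_exp(1)[OF assms]
      by (intro integral_mono) auto
    also have "\<dots> \<le> exp (t\<^sup>2 * c)"
      using subgaussian_rel_exp(2)[OF assms, of t] by (simp add: c_def mult.assoc)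
    finally show ?thesis .
  qed
  \<comment> \<open>The test point is t = s \<mu>. The denominator forces 4 s c < 1 and s \<mu>^2 <=
    1, so that \<open>y\<close> is at most 1 and exp y <= 1 + 2 y leads to 1 <= 2 s c, a
    contradiction.\<close>
  define s where "s = 1 / (1 + 4 * c + \<mu>\<^sup>2)"
  have "0 < 1 + 4 * c + \<mu>\<^sup>2" using \<open>0 \<le> c\<close> \<open>0 < \<mu>\<^sup>2\<close> by linarith
  then have "0 < s" and sc: "s * (1 + 4 * c + \<mu>\<^sup>2) = 1" by (simp_all add: s_def)
  from sc have sum1: "s + 4 * (s * c) + s * \<mu>\<^sup>2 = 1" by (simp add: algebra_simps)
  have "0 \<le> s * c" "0 \<le> s * \<mu>\<^sup>2" using \<open>0 < s\<close> \<open>0 \<le> c\<close> by auto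
  with sum1 \<open>0 < s\<close> have small: "4 * (s * c) < 1" "s * \<mu>\<^sup>2 \<le> 1" by linarith+
  define y where "y = (s * \<mu>)\<^sup>2 * c"
  have y: "y = (s * c) * (s * \<mu>\<^sup>2)" by (simp add: y_def power2_eq_square algebra_simps)
  have "y \<le> (s * c) * 1" unfolding y using small \<open>0 \<le> s * c\<close> by (intro mult_left_mono) auto
  then have "0 \<le> y" "y \<le> 1" using small \<open>0 \<le> s * c\<close> \<open>0 \<le> c\<close> by (auto simp: y_def)
  have "1 + s * \<mu>\<^sup>2 \<le> exp y" using lin[of "s * \<mu>"] by (simp add: y_def power2_eq_square mult.assoc)
  also have "\<dots> \<le> 1 + y + y\<^sup>2" using \<open>0 \<le> y\<close> \<open>y \<le> 1\<close> by (rule exp_bound)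
  also have "\<dots> \<le> 1 + 2 * y"
    using \<open>0 \<le> y\<close> \<open>y \<le> 1\<close> by (simp add: power2_eq_square mult_left_le)
  finally have "1 * (s * \<mu>\<^sup>2) \<le> (2 * (s * c)) * (s * \<mu>\<^sup>2)" by (simp add: y)
  moreover have "0 < s * \<mu>\<^sup>2" using \<open>0 < s\<close> \<open>0 < \<mu>\<^sup>2\<close> by simp
  ultimately have "1 \<le> 2 * (s * c)" by (simp only: mult_le_cancel_right)
  then show False using small by linarith
qed

text \<open>At t = 1 / (\<rho> \<sigma>) both exp (t Z) and exp (- t Z) have expectation at most exp
  (1/2) <= 2, and t^4 Z^4 is at most 64 times their sum; hence 64 * 4 = 256.\<close>

lemma subgaussian_rel_fourth_moment:
  assumes "subgaussian_rel M \<rho> Z" "0 < \<rho>"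
    and \<sigma>: "expectation (\<lambda>x. (Z x)\<^sup>2) = \<sigma>\<^sup>2" "0 < \<sigma>"
  shows "integrable M (\<lambda>x. Z x ^ 4)" "expectation (\<lambda>x. Z x ^ 4) \<le> 256 * \<rho> ^ 4 * \<sigma> ^ 4"
proof -
  have [measurable]: "Z \<in> borel_measurable M" using assms by (simp add: subgaussian_rel_def)
  define t where "t = 1 / (\<rho> * \<sigma>)"
  have "0 < t" using assms by (simp add: t_def)
  have le: "t ^ 4 * Z x ^ 4 \<le> 64 * (exp (t * Z x) + exp (- t * Z x))" for x
    using pow4_le_exp[of "t * Z x"] by (simp add: power_mult_distrib)
  have int: "integrable M (\<lambda>x. 64 * (exp (t * Z x) + exp (- t * Z x)))"
    using subgaussian_rel_exp(1)[OF assms(1), of t] subgaussian_rel_exp(1)[OF assms(1), of "- t"]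
    by (intro integrable_mult_right Bochner_Integration.integrable_add) auto
  have int4: "integrable M (\<lambda>x. t ^ 4 * Z x ^ 4)"
    using le by (intro Bochner_Integration.integrable_bound[OF int]) (auto simp: abs_mult)
  then show "integrable M (\<lambda>x. Z x ^ 4)" using \<open>0 < t\<close> by simp
  have b: "expectation (\<lambda>x. exp (s * Z x)) \<le> 2" if "s = t \<or> s = - t" for s
  proof -
    have "s\<^sup>2 * \<rho>\<^sup>2 * expectation (\<lambda>x. (Z x)\<^sup>2) / 2 = 1 / 2"
      using that assms by (auto simp: t_def \<sigma>(1) power_mult_distrib power_divide)
    then have "expectation (\<lambda>x. exp (s * Z x)) \<le> exp (1 / 2)"
      using subgaussian_rel_exp(2)[OF assms(1), of s] by simp
    also have "\<dots> \<le> 2" using exp_bound_half[of "1/2::real"] by simp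
    finally show ?thesis .
  qed
  have "t ^ 4 * expectation (\<lambda>x. Z x ^ 4) = expectation (\<lambda>x. t ^ 4 * Z x ^ 4)" by simp
  also have "\<dots> \<le> expectation (\<lambda>x. 64 * (exp (t * Z x) + exp (- t * Z x)))"
    using le by (intro integral_mono int4 int)
  also have "\<dots> = 64 * (expectation (\<lambda>x. exp (t * Z x)) + expectation (\<lambda>x. exp (- t * Z x)))"
    using subgaussian_rel_exp(1)[OF assms(1), of t] subgaussian_rel_exp(1)[OF assms(1), of "- t"]
    by (subst integral_mult_right_zero, subst Bochner_Integration.integral_add) auto
  also have "\<dots> \<le> 256" using b[of t] b[of "- t"] by simp
  finally have "t ^ 4 * expectation (\<lambda>x. Z x ^ 4) \<le> 256" .
  then have "(\<rho> * \<sigma>) ^ 4 * (t ^ 4 * expectation (\<lambda>x. Z x ^ 4)) \<le> (\<rho> * \<sigma>) ^ 4 * 256"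
    by (intro mult_left_mono) auto
  moreover have "(\<rho> * \<sigma>) ^ 4 * t ^ 4 = 1" using assms by (simp add: t_def power_divide)
  ultimately show "expectation (\<lambda>x. Z x ^ 4) \<le> 256 * \<rho> ^ 4 * \<sigma> ^ 4"
    by (simp add: mult.assoc[symmetric] power_mult_distrib mult.commute[of _ 256])
qed

text \<open>The fourth moment controls the second-order term in the expansion of exp (- a Z^2), and
  the bound \<open>small\<close> makes this term at most half the linear one.\<close>

lemma subgaussian_rel_exp_neg_square:
  assumes "subgaussian_rel M \<rho> Z" "0 < \<rho>" "0 \<le> a"
    and small: "a * expectation (\<lambda>x. (Z x)\<^sup>2) \<le> 1 / (256 * \<rho> ^ 4)"
  shows "expectation (\<lambda>x. exp (- a * (Z x)\<^sup>2)) \<le> exp (- a * expectation (\<lambda>x. (Z x)\<^sup>2) / 2)"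
proof -
  have [measurable]: "Z \<in> borel_measurable M" using assms by (simp add: subgaussian_rel_def)
  have int2: "integrable M (\<lambda>x. (Z x)\<^sup>2)" using assms by (simp add: subgaussian_rel_def)
  have int: "integrable M (\<lambda>x. exp (- a * (Z x)\<^sup>2))"
    using \<open>0 \<le> a\<close> by (intro integrable_const_bound[where B = 1]) auto
  define \<sigma> where "\<sigma> = sqrt (expectation (\<lambda>x. (Z x)\<^sup>2))"
  have \<sigma>: "expectation (\<lambda>x. (Z x)\<^sup>2) = \<sigma>\<^sup>2" "0 \<le> \<sigma>" by (simp_all add: \<sigma>_def)
  show ?thesis
  \<comment> \<open>A vanishing second moment is split off because the fourth-moment bound divides
    by \<open>\<sigma>\<close>.\<close>
  proof (cases "\<sigma> = 0")
    case True
    have "expectation (\<lambda>x. exp (- a * (Z x)\<^sup>2)) \<le> expectation (\<lambda>x. 1)"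
      using int \<open>0 \<le> a\<close> by (intro integral_mono) auto
    then show ?thesis using True \<sigma> by (simp add: prob_space)
  next
    case False
    then have "0 < \<sigma>" using \<sigma> by simp
    note m4 = subgaussian_rel_fourth_moment[OF assms(1,2) \<sigma>(1) \<open>0 < \<sigma>\<close>]
    define x where "x = a * \<sigma>\<^sup>2"
    have "0 \<le> x" using \<open>0 \<le> a\<close> by (simp add: x_def)
    have x: "256 * \<rho> ^ 4 * x \<le> 1"
      using small \<open>0 < \<rho>\<close> by (simp add: \<sigma> x_def field_simps)
    have "expectation (\<lambda>x. exp (- a * (Z x)\<^sup>2)) \<le> expectation (\<lambda>x. 1 - a * (Z x)\<^sup>2 + a\<^sup>2 / 2 * Z x ^ 4)"
    proof (intro integral_mono int)
      show "integrable M (\<lambda>x. 1 - a * (Z x)\<^sup>2 + a\<^sup>2 / 2 * Z x ^ 4)" using int2 m4(1) by simp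
      show "exp (- a * (Z x)\<^sup>2) \<le> 1 - a * (Z x)\<^sup>2 + a\<^sup>2 / 2 * Z x ^ 4" for x
        using exp_minus_le_quadratic[of "a * (Z x)\<^sup>2"] \<open>0 \<le> a\<close>
        by (simp add: power_mult_distrib)
    qed
    also have "\<dots> = 1 - a * \<sigma>\<^sup>2 + a\<^sup>2 / 2 * expectation (\<lambda>x. Z x ^ 4)"
      using int2 m4(1) by (simp add: prob_space \<sigma>)
    also have "\<dots> \<le> 1 - a * \<sigma>\<^sup>2 + a\<^sup>2 / 2 * (256 * \<rho> ^ 4 * \<sigma> ^ 4)"
      using m4(2) by (intro add_left_mono mult_left_mono) auto
    also have "\<dots> = 1 - x + (256 * \<rho> ^ 4 * x) * x / 2"
    proof -
      have "\<sigma> ^ 4 = \<sigma>\<^sup>2 * \<sigma>\<^sup>2" by (simp flip: power_add)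
      then show ?thesis by (simp add: x_def power2_eq_square)
    qed
    also have "\<dots> \<le> 1 - x + 1 * x / 2"
      using x \<open>0 \<le> x\<close> by (intro add_left_mono divide_right_mono mult_right_mono) auto
    also have "\<dots> \<le> exp (- x / 2)" using exp_ge_add_one_self[of "- x / 2"] by simp
    finally show ?thesis by (simp add: \<sigma> x_def)
  qed
qed

text \<open>Independence factors the exponential moment and, with zero means, makes second moments
  additive. The exponents then add up to exactly the bound for the sum, so \<open>\<rho>\<close>
  does not grow with the number of summands.\<close>

lemma subgaussian_rel_lincomb:
  fixes Y :: "'i \<Rightarrow> 'a \<Rightarrow> real"
  assumes I: "finite I" and indep: "indep_vars (\<lambda>_. borel) Y I"
    and sub: "\<And>i. i \<in> I \<Longrightarrow> subgaussian_rel M \<rho> (Y i)"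
  shows "subgaussian_rel M \<rho> (\<lambda>x. \<Sum>i\<in>I. u i * Y i x)"
    and "expectation (\<lambda>x. (\<Sum>i\<in>I. u i * Y i x)\<^sup>2) = (\<Sum>i\<in>I. (u i)\<^sup>2 * expectation (\<lambda>x. (Y i x)\<^sup>2))"
proof -
  have [measurable]: "Y i \<in> borel_measurable M" if "i \<in> I" for i
    using sub[OF that] by (simp add: subgaussian_rel_def)
  have int2: "integrable M (\<lambda>x. (Y i x)\<^sup>2)" if "i \<in> I" for i
    using sub[OF that] by (simp add: subgaussian_rel_def)
  have prod: "integrable M (\<lambda>x. Y i x * Y k x) \<and>
      expectation (\<lambda>x. Y i x * Y k x) = (if i = k then expectation (\<lambda>x. (Y i x)\<^sup>2) else 0)"
    if "i \<in> I" "k \<in> I" for i k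
  proof (cases "i = k")
    case True
    then show ?thesis using int2[OF \<open>i \<in> I\<close>] by (simp add: power2_eq_square)
  next
    case False
    have "indep_vars (\<lambda>_. borel) Y {i, k}"
      using indep that by (intro indep_vars_subset[OF indep]) auto
    moreover have "\<And>l. l \<in> {i, k} \<Longrightarrow> integrable M (Y l)"
      using that sub subgaussian_rel_integrable by blast
    ultimately show ?thesis
      using indep_vars_lebesgue_integral[of "{i, k}" Y] indep_vars_integrable[of "{i, k}" Y] False
        subgaussian_rel_mean_zero[OF sub[OF \<open>i \<in> I\<close>]] by simp
  qed
  have sq: "(\<Sum>i\<in>I. u i * Y i x)\<^sup>2 = (\<Sum>i\<in>I. \<Sum>k\<in>I. u i * u k * (Y i x * Y k x))" for x
    by (simp add: power2_eq_square sum_product algebra_simps)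
  have int: "integrable M (\<lambda>x. (\<Sum>i\<in>I. u i * Y i x)\<^sup>2)"
    unfolding sq using prod by (intro Bochner_Integration.integrable_sum integrable_mult_right) auto
  show var: "expectation (\<lambda>x. (\<Sum>i\<in>I. u i * Y i x)\<^sup>2) = (\<Sum>i\<in>I. (u i)\<^sup>2 * expectation (\<lambda>x. (Y i x)\<^sup>2))"
  proof -
    have "expectation (\<lambda>x. (\<Sum>i\<in>I. u i * Y i x)\<^sup>2)
        = (\<Sum>i\<in>I. \<Sum>k\<in>I. u i * u k * expectation (\<lambda>x. Y i x * Y k x))"
      unfolding sq using prod by (simp add: Bochner_Integration.integral_sum integrable_mult_right)
    also have "\<dots> = (\<Sum>i\<in>I. \<Sum>k\<in>I. if i = k then (u i)\<^sup>2 * expectation (\<lambda>x. (Y i x)\<^sup>2) else 0)"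
    proof (intro sum.cong refl)
      fix i k assume "i \<in> I" "k \<in> I"
      then have "expectation (\<lambda>x. Y i x * Y k x) = (if i = k then expectation (\<lambda>x. (Y i x)\<^sup>2) else 0)"
        using prod by blast
      then show "u i * u k * expectation (\<lambda>x. Y i x * Y k x)
          = (if i = k then (u i)\<^sup>2 * expectation (\<lambda>x. (Y i x)\<^sup>2) else 0)"
        by (simp add: power2_eq_square)
    qed
    finally show ?thesis using I by simp
  qed
  show "subgaussian_rel M \<rho> (\<lambda>x. \<Sum>i\<in>I. u i * Y i x)"
    unfolding subgaussian_rel_def
  proof (intro conjI allI int)
    fix t :: real
    let ?e = "\<lambda>i. (t * u i)\<^sup>2 * \<rho>\<^sup>2 * expectation (\<lambda>x. (Y i x)\<^sup>2) / 2"
    have ind: "indep_vars (\<lambda>_. borel) (\<lambda>i x. ennreal (exp (t * u i * Y i x))) I"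
      by (rule indep_vars_compose2[OF indep, of "\<lambda>i y. ennreal (exp (t * u i * y))"]) measurable
    have "(\<integral>\<^sup>+x. ennreal (exp (t * (\<Sum>i\<in>I. u i * Y i x))) \<partial>M)
        = (\<integral>\<^sup>+x. (\<Prod>i\<in>I. ennreal (exp (t * u i * Y i x))) \<partial>M)"
      using I by (intro nn_integral_cong) (simp add: exp_sum sum_distrib_left prod_ennreal mult.assoc)
    also have "\<dots> = (\<Prod>i\<in>I. \<integral>\<^sup>+x. ennreal (exp (t * u i * Y i x)) \<partial>M)"
      using I ind by (intro indep_vars_nn_integral) auto
    also have "\<dots> \<le> (\<Prod>i\<in>I. ennreal (exp (?e i)))"
      using sub by (intro prod_mono_ennreal) (auto simp: subgaussian_rel_def)
    also have "\<dots> = ennreal (exp (\<Sum>i\<in>I. ?e i))"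
      using I by (simp add: prod_ennreal exp_sum)
    also have "(\<Sum>i\<in>I. ?e i) = t\<^sup>2 * \<rho>\<^sup>2 * expectation (\<lambda>x. (\<Sum>i\<in>I. u i * Y i x)\<^sup>2) / 2"
      unfolding var sum_distrib_left sum_divide_distrib
      by (intro sum.cong) (auto simp: power_mult_distrib)
    finally show "(\<integral>\<^sup>+x. ennreal (exp (t * (\<Sum>i\<in>I. u i * Y i x))) \<partial>M)
        \<le> ennreal (exp (t\<^sup>2 * \<rho>\<^sup>2 * expectation (\<lambda>x. (\<Sum>i\<in>I. u i * Y i x)\<^sup>2) / 2))" .
  qed simp
qed

text \<open>Chernoff's method with a negative exponent. For fixed \<open>u\<close> the variables
  \<open>V j\<close> are independent and the quadratic form has mean r T. Each factor exp (- s
  \<theta>_j V_j^2) has expectation at most exp of minus half its mean exponent, so the event of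
  falling to a quarter of r T has probability at most exp (- s r T / 4).\<close>

lemma random_matrix_lower_tail:
  fixes Z :: "nat \<Rightarrow> nat \<Rightarrow> 'a \<Rightarrow> real" and lam \<theta> u :: "nat \<Rightarrow> real" and m d :: nat
  assumes "0 < \<rho>"
    and indep: "indep_vars (\<lambda>_. borel) (\<lambda>(i, j). Z i j) ({..<m} \<times> {..<d})"
    and sub: "\<And>i j. i < m \<Longrightarrow> j < d \<Longrightarrow> subgaussian_rel M \<rho> (Z i j)"
    and var: "\<And>i j. i < m \<Longrightarrow> j < d \<Longrightarrow> expectation (\<lambda>x. (Z i j x)\<^sup>2) = lam j"
    and \<theta>: "\<And>j. j < d \<Longrightarrow> 0 \<le> \<theta> j" "\<And>j. j < d \<Longrightarrow> \<theta> j * lam j \<le> g" and "0 < g"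
    and T: "T = (\<Sum>j<d. \<theta> j * lam j)"
    and r: "r = (\<Sum>i<m. (u i)\<^sup>2)" "0 < r"
  shows "prob {x \<in> space M. (\<Sum>j<d. \<theta> j * (\<Sum>i<m. u i * Z i j x)\<^sup>2) \<le> r * T / 4}
    \<le> exp (- T / (1024 * \<rho> ^ 4 * g))"
proof -
  have [measurable]: "Z i j \<in> borel_measurable M" if "i < m" "j < d" for i j
    using sub[OF that] by (simp add: subgaussian_rel_def)
  define V where "V j x = (\<Sum>i<m. u i * Z i j x)" for j x
  have [measurable]: "V j \<in> borel_measurable M" if "j < d" for j
    unfolding V_def using that by measurable
  have V: "subgaussian_rel M \<rho> (V j)" "expectation (\<lambda>x. (V j x)\<^sup>2) = r * lam j" if "j < d" for j
  proof -
    have ind: "indep_vars (\<lambda>_. borel) (\<lambda>i. Z i j) {..<m}"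
    proof -
      \<comment> \<open>One-point blocks turn independence indexed by pairs into independence of one
        column indexed by rows.\<close>
      have "indep_vars (\<lambda>i. PiM {(i, j)} (\<lambda>_. borel))
          (\<lambda>i x. restrict (\<lambda>p. (case p of (i, j) \<Rightarrow> Z i j) x) {(i, j)}) {..<m}"
        using that by (intro indep_vars_restrict[OF indep]) (auto simp: disjoint_family_on_def)
      then have "indep_vars (\<lambda>_. borel)
          (\<lambda>i x. (restrict (\<lambda>p. (case p of (i, j) \<Rightarrow> Z i j) x) {(i, j)}) (i, j)) {..<m}"
        by (rule indep_vars_compose2[where Y = "\<lambda>i h. h (i, j)"]) simp
      then show ?thesis by simp
    qed
    show "subgaussian_rel M \<rho> (V j)" unfolding V_def
      using that sub by (intro subgaussian_rel_lincomb(1)[OF _ ind]) auto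
    have "expectation (\<lambda>x. (V j x)\<^sup>2) = (\<Sum>i<m. (u i)\<^sup>2 * expectation (\<lambda>x. (Z i j x)\<^sup>2))"
      unfolding V_def using that sub by (intro subgaussian_rel_lincomb(2)[OF _ ind]) auto
    also have "\<dots> = (\<Sum>i<m. (u i)\<^sup>2 * lam j)"
      using var that by (intro sum.cong) auto
    finally show "expectation (\<lambda>x. (V j x)\<^sup>2) = r * lam j" by (simp add: r sum_distrib_right)
  qed
  \<comment> \<open>The largest \<open>s\<close> for which the bound \<open>g\<close> ensures the
    smallness condition of \<open>subgaussian_rel_exp_neg_square\<close>: s \<theta>_j r lam_j <= s
    r g = 1 / (256 \<rho>^4).\<close>
  define s where "s = 1 / (256 * \<rho> ^ 4 * g * r)"
  have "0 < s" using assms by (simp add: s_def)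
  define E where "E j x = exp (- (s * \<theta> j) * (V j x)\<^sup>2)" for j x
  have E_int: "integrable M (E j)" if "j < d" for j
    unfolding E_def using that \<open>0 < s\<close> \<theta>(1)[OF that]
    by (intro integrable_const_bound[where B = 1]) auto
  have E_le: "expectation (E j) \<le> exp (- (s * \<theta> j) * (r * lam j) / 2)" if "j < d" for j
  proof -
    have "(s * \<theta> j) * (r * lam j) = s * r * (\<theta> j * lam j)" by simp
    also have "\<dots> \<le> s * r * g"
      using \<theta>(2)[OF that] \<open>0 < s\<close> r by (intro mult_left_mono) auto
    also have "\<dots> = 1 / (256 * \<rho> ^ 4)" using assms by (simp add: s_def)
    finally have "(s * \<theta> j) * expectation (\<lambda>x. (V j x)\<^sup>2) \<le> 1 / (256 * \<rho> ^ 4)"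
      using V(2)[OF that] by simp
    then have "expectation (E j) \<le> exp (- (s * \<theta> j) * expectation (\<lambda>x. (V j x)\<^sup>2) / 2)"
      unfolding E_def using \<open>0 < s\<close> \<theta>(1)[OF that] \<open>0 < \<rho>\<close> V(1)[OF that]
      by (intro subgaussian_rel_exp_neg_square) auto
    then show ?thesis using V(2)[OF that] by simp
  qed
  have indepE: "indep_vars (\<lambda>_. borel) E {..<d}"
  proof -
    \<comment> \<open>Each \<open>E j\<close> is a function of the \<open>j\<close>-th column, and
      these blocks are disjoint.\<close>
    let ?K = "\<lambda>j. {..<m} \<times> {j}"
    let ?f = "\<lambda>j h. exp (- (s * \<theta> j) * (\<Sum>i<m. u i * h (i, j))\<^sup>2)"
    have "indep_vars (\<lambda>j. PiM (?K j) (\<lambda>_. borel))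
        (\<lambda>j x. restrict (\<lambda>p. (case p of (i, j) \<Rightarrow> Z i j) x) (?K j)) {..<d}"
      by (intro indep_vars_restrict[OF indep]) (auto simp: disjoint_family_on_def)
    then have "indep_vars (\<lambda>_. borel)
        (\<lambda>j x. ?f j (restrict (\<lambda>p. (case p of (i, j) \<Rightarrow> Z i j) x) (?K j))) {..<d}"
      by (rule indep_vars_compose2[where Y = ?f]) measurable
    moreover have "(\<lambda>x. ?f j (restrict (\<lambda>p. (case p of (i, j) \<Rightarrow> Z i j) x) (?K j))) = E j" for j
      by (auto simp: E_def V_def intro!: sum.cong)
    ultimately show ?thesis by simp
  qed
  have int_prod: "integrable M (\<lambda>x. \<Prod>j<d. E j x)"
    and E_prod: "expectation (\<lambda>x. \<Prod>j<d. E j x) = (\<Prod>j<d. expectation (E j))"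
    using indep_vars_integrable[OF _ indepE] indep_vars_lebesgue_integral[OF _ indepE] E_int by auto
  have E_sum: "(\<Prod>j<d. E j x) = exp (- (s * (\<Sum>j<d. \<theta> j * (V j x)\<^sup>2)))" for x
    by (simp add: E_def exp_sum[symmetric] sum_negf sum_distrib_left mult.assoc)
  have "{x \<in> space M. (\<Sum>j<d. \<theta> j * (V j x)\<^sup>2) \<le> r * T / 4}
      = {x \<in> space M. exp (- (s * (r * T / 4))) \<le> (\<Prod>j<d. E j x)}"
    unfolding E_sum using \<open>0 < s\<close> by auto
  also have "prob \<dots> \<le> expectation (\<lambda>x. \<Prod>j<d. E j x) / exp (- (s * (r * T / 4)))"
    by (rule integral_Markov_inequality_measure[OF int_prod, of "{}"]) (auto simp: E_sum)
  also have "expectation (\<lambda>x. \<Prod>j<d. E j x) \<le> (\<Prod>j<d. exp (- (s * \<theta> j) * (r * lam j) / 2))"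
    unfolding E_prod using E_le by (intro prod_mono) (auto simp: E_def intro: integral_nonneg_AE)
  also have "\<dots> = exp (- (s * r * T / 2))"
    unfolding exp_sum[OF finite_lessThan, symmetric]
    by (simp add: T sum_distrib_left sum_negf sum_divide_distrib algebra_simps)
  also have "exp (- (s * r * T / 2)) / exp (- (s * (r * T / 4))) = exp (- (s * r * T / 4))"
    by (simp flip: exp_diff)
  also have "s * r * T / 4 = T / (1024 * \<rho> ^ 4 * g)"
    using assms by (simp add: s_def)
  finally show ?thesis by (simp add: V_def divide_right_mono)
qed

text \<open>A net argument on the l1-sphere of radius \<open>m\<close>. Markov's inequality bounds
  the trace \<open>N\<close> and a union bound handles the lower tail on the grid; the failure
  probabilities sum to less than 1/2. With radius \<open>m\<close> the coordinates have average size
  1, so the mesh 1/8 works for every \<open>m\<close>.\<close>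

lemma random_matrix_good_event:
  fixes Z :: "nat \<Rightarrow> nat \<Rightarrow> 'a \<Rightarrow> real" and lam \<theta> :: "nat \<Rightarrow> real" and m d :: nat
  assumes "0 < \<rho>"
    and indep: "indep_vars (\<lambda>_. borel) (\<lambda>(i, j). Z i j) ({..<m} \<times> {..<d})"
    and sub: "\<And>i j. i < m \<Longrightarrow> j < d \<Longrightarrow> subgaussian_rel M \<rho> (Z i j)"
    and var: "\<And>i j. i < m \<Longrightarrow> j < d \<Longrightarrow> expectation (\<lambda>x. (Z i j x)\<^sup>2) = lam j"
    and \<theta>: "\<And>j. j < d \<Longrightarrow> 0 \<le> \<theta> j" "\<And>j. j < d \<Longrightarrow> \<theta> j * lam j \<le> g" and "0 < g"
    and T: "T = (\<Sum>j<d. \<theta> j * lam j)" "0 < T"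
    and m: "8 * real m + 2 \<le> T / (1024 * \<rho> ^ 4 * g)"
  shows "\<exists>G\<in>events. 1 / 2 < prob G \<and> (\<forall>x\<in>G. \<forall>v. (\<Sum>i<m. \<bar>v i\<bar>) = real m \<longrightarrow>
           real m * T / 8 \<le> (\<Sum>j<d. \<theta> j * (\<Sum>i<m. v i * Z i j x)\<^sup>2))"
proof (cases "m = 0")
  case True
  then show ?thesis using \<theta>(1) by (intro bexI[of _ "space M"]) (auto simp: prob_space)
next
  case False
  then have "0 < m" by simp
  have [measurable]: "Z i j \<in> borel_measurable M" if "i < m" "j < d" for i j
    using sub[OF that] by (simp add: subgaussian_rel_def)
  define N where "N x = (\<Sum>i<m. \<Sum>j<d. \<theta> j * (Z i j x)\<^sup>2)" for x
  define q where "q v x = (\<Sum>j<d. \<theta> j * (\<Sum>i<m. v i * Z i j x)\<^sup>2)" for v x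
  have [measurable]: "N \<in> borel_measurable M" "q v \<in> borel_measurable M" for v
    unfolding N_def q_def by measurable
  define sc :: "(nat \<Rightarrow> int) \<Rightarrow> nat \<Rightarrow> real" where "sc k i = of_int (k i) / 8" for k i
  define R where "R k = (\<Sum>i<m. (sc k i)\<^sup>2)" for k
  \<comment> \<open>Rounding adds at most 1/8 per coordinate to the l1-norm \<open>m\<close>, so in
    units of 1/8 the norm is at most 8 (m + m/8) = 9 m. The zero vector is excluded because the
    lower tail requires \<open>R k\<close> to be positive.\<close>
  define F where "F = {k \<in> l1_grid m (9 * m). 0 < R k}"
  have "finite F" unfolding F_def using finite_l1_grid by simp
  define B1 where "B1 = {x \<in> space M. 4 * m * T \<le> N x}"
  define B2 where "B2 k = {x \<in> space M. q (sc k) x \<le> R k * T / 4}" for k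
  have B_events[measurable]: "B1 \<in> events" "B2 k \<in> events" for k
    unfolding B1_def B2_def by measurable
  have "prob B1 \<le> expectation N / (4 * m * T)"
    and intN: "integrable M N" and EN: "expectation N = m * T"
  proof -
    have int2: "integrable M (\<lambda>x. \<theta> j * (Z i j x)\<^sup>2)" if "i < m" "j < d" for i j
      using sub[OF that] by (intro integrable_mult_right) (simp add: subgaussian_rel_def)
    show intN: "integrable M N"
      unfolding N_def using int2 by (intro Bochner_Integration.integrable_sum) auto
    show "prob B1 \<le> expectation N / (4 * m * T)"
      unfolding B1_def using \<open>0 < m\<close> \<open>0 < T\<close> \<theta>(1)
      by (intro integral_Markov_inequality_measure[OF intN, of "{}"]) (auto simp: N_def intro!: sum_nonneg)
    have "expectation N = (\<Sum>i<m. \<Sum>j<d. expectation (\<lambda>x. \<theta> j * (Z i j x)\<^sup>2))"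
    proof -
      have "expectation N = (\<Sum>i<m. expectation (\<lambda>x. \<Sum>j<d. \<theta> j * (Z i j x)\<^sup>2))"
        unfolding N_def using int2
        by (intro Bochner_Integration.integral_sum Bochner_Integration.integrable_sum) auto
      also have "\<dots> = (\<Sum>i<m. \<Sum>j<d. expectation (\<lambda>x. \<theta> j * (Z i j x)\<^sup>2))"
        using int2 by (intro sum.cong refl Bochner_Integration.integral_sum) auto
      finally show ?thesis .
    qed
    also have "\<dots> = (\<Sum>i<m. \<Sum>j<d. \<theta> j * lam j)"
      using var by (intro sum.cong) auto
    finally show "expectation N = m * T" by (simp add: T)
  qed
  then have pB1: "prob B1 \<le> 1 / 4" using \<open>0 < m\<close> \<open>0 < T\<close> by simp
  have "prob (\<Union>k\<in>F. B2 k) \<le> (\<Sum>k\<in>F. prob (B2 k))"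
    using \<open>finite F\<close> B_events by (intro finite_measure_subadditive_finite) auto
  also have "\<dots> \<le> (\<Sum>k\<in>F. exp (- T / (1024 * \<rho> ^ 4 * g)))"
  proof (rule sum_mono)
    fix k assume "k \<in> F"
    then show "prob (B2 k) \<le> exp (- T / (1024 * \<rho> ^ 4 * g))"
      unfolding B2_def q_def
      by (intro random_matrix_lower_tail[OF \<open>0 < \<rho>\<close> indep sub var \<theta> \<open>0 < g\<close> T(1), of "R k" "sc k"])
        (auto simp: F_def R_def)
  qed
  also have "\<dots> = real (card F) * exp (- T / (1024 * \<rho> ^ 4 * g))" by simp
  \<comment> \<open>The net has at most (3 * 512)^m = 1536^m points, and 1536 <= exp 8, so the
    exponent 8 m + 2 leaves exp (- 2).\<close>
  also have "\<dots> \<le> (3 ^ m * 2 ^ (9 * m)) * exp (- (8 * real m + 2))"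
  proof (rule mult_mono)
    have "card F \<le> card (l1_grid m (9 * m))"
      unfolding F_def by (intro card_mono finite_l1_grid) auto
    then show "real (card F) \<le> 3 ^ m * 2 ^ (9 * m)"
      using card_l1_grid[of m "9 * m"] by linarith
  qed (use m in auto)
  also have "3 ^ m * 2 ^ (9 * m) = (1536::real) ^ m"
    by (simp add: power_mult power_mult_distrib[symmetric])
  also have "(1536::real) ^ m * exp (- (8 * real m + 2)) \<le> exp 8 ^ m * exp (- (8 * real m + 2))"
  proof (intro mult_right_mono power_mono)
    have "1.625 \<le> exp (1 / 2 :: real)" using exp_lower_Taylor_quadratic[of "1/2"] by (simp add: power2_eq_square)
    then have "1.625 ^ 16 \<le> exp (1 / 2 :: real) ^ 16" by (intro power_mono) auto
    also have "\<dots> = exp 8" by (simp flip: exp_of_nat_mult)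
    finally show "1536 \<le> exp (8::real)" by (simp add: power_divide)
  qed auto
  also have "\<dots> = exp (- 2)" by (simp flip: exp_of_nat_mult exp_add)
  also have "\<dots> < 1 / 4"
  proof -
    have "4 < exp (2::real)" using exp_lower_Taylor_quadratic[of 2] by simp
    then show ?thesis by (simp add: exp_minus field_simps)
  qed
  finally have pB2: "prob (\<Union>k\<in>F. B2 k) < 1 / 4" .
  have U_events: "B1 \<union> (\<Union>k\<in>F. B2 k) \<in> events"
    using \<open>finite F\<close> B_events by (intro sets.Un sets.finite_UN) auto
  define G where "G = space M - (B1 \<union> (\<Union>k\<in>F. B2 k))"
  have "prob (B1 \<union> (\<Union>k\<in>F. B2 k)) \<le> prob B1 + prob (\<Union>k\<in>F. B2 k)"
    using \<open>finite F\<close> B_events by (intro measure_Un_le sets.finite_UN) auto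
  moreover have "prob G = 1 - prob (B1 \<union> (\<Union>k\<in>F. B2 k))"
    unfolding G_def using U_events by (rule prob_compl)
  ultimately have "1 / 2 < prob G" using pB1 pB2 by linarith
  moreover have "G \<in> events" unfolding G_def using U_events by auto
  moreover have "real m * T / 8 \<le> q v x" if "x \<in> G" "(\<Sum>i<m. \<bar>v i\<bar>) = real m" for x v
  proof -
    \<comment> \<open>Absorbing the square roots of the weights into the entries gives the plain sum
      of squares that \<open>round_to_grid\<close> expects.\<close>
    let ?z = "\<lambda>i j. sqrt (\<theta> j) * Z i j x"
    have q_z: "(\<Sum>j<d. (0 + (\<Sum>i<m. w i * ?z i j))\<^sup>2) = q w x" for w
    proof -
      have "(\<Sum>i<m. w i * ?z i j) = sqrt (\<theta> j) * (\<Sum>i<m. w i * Z i j x)" for j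
        by (simp add: sum_distrib_left algebra_simps)
      then show ?thesis using \<theta>(1) by (simp add: q_def power_mult_distrib)
    qed
    have N_z: "(\<Sum>i<m. \<Sum>j<d. (?z i j)\<^sup>2) = N x"
      using \<theta>(1) by (simp add: N_def power_mult_distrib)
    obtain k' :: "nat \<Rightarrow> int" where k': "\<And>i. i < m \<Longrightarrow> \<bar>v i - 1/8 * of_int (k' i)\<bar> \<le> 1/8"
      "(\<Sum>j<d. (0 + (\<Sum>i<m. 1/8 * of_int (k' i) * ?z i j))\<^sup>2)
        \<le> (\<Sum>j<d. (0 + (\<Sum>i<m. v i * ?z i j))\<^sup>2) + (1/8)\<^sup>2 / 4 * (\<Sum>i<m. \<Sum>j<d. (?z i j)\<^sup>2)"
      using round_to_grid[where h = "1/8" and m = m and v = v and d = d and b = "\<lambda>_. 0" and z = ?z] by auto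
    define k where "k = restrict k' {..<m}"
    have sck: "sc k i = 1/8 * of_int (k' i)" if "i < m" for i using that by (simp add: sc_def k_def)
    have near: "\<bar>v i - sc k i\<bar> \<le> 1/8" if "i < m" for i unfolding sck[OF that] by (rule k'(1)[OF that])
    have qk: "q (sc k) x \<le> q v x + N x / 256"
    proof -
      have "q (sc k) x = q (\<lambda>i. 1/8 * of_int (k' i)) x"
        unfolding q_def by (intro sum.cong arg_cong2[where f = "(*)"] arg_cong[where f = power2] refl)
          (simp add: sc_def k_def)
      then show ?thesis using k'(2) unfolding q_z N_z by (simp add: power2_eq_square)
    qed
    have up: "(\<Sum>i<m. \<bar>sc k i\<bar>) \<le> 9/8 * m" and low: "7/8 * m \<le> (\<Sum>i<m. \<bar>sc k i\<bar>)"
    proof -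
      have "(\<Sum>i<m. \<bar>sc k i\<bar>) \<le> (\<Sum>i<m. \<bar>v i\<bar> + 1/8)"
        using near by (intro sum_mono) (smt (verit) lessThan_iff)
      then show "(\<Sum>i<m. \<bar>sc k i\<bar>) \<le> 9/8 * m" using that by (simp add: sum.distrib)
      have "(\<Sum>i<m. \<bar>v i\<bar> - 1/8) \<le> (\<Sum>i<m. \<bar>sc k i\<bar>)"
        using near by (intro sum_mono) (smt (verit) lessThan_iff)
      then show "7/8 * m \<le> (\<Sum>i<m. \<bar>sc k i\<bar>)" using that by (simp add: sum_subtractf)
    qed
    \<comment> \<open>By Cauchy-Schwarz an l1-norm of at least 7 m / 8 forces the squared l2-norm
      \<open>R k\<close> to be at least 49 m / 64.\<close>
    have "(7/8 * m)\<^sup>2 \<le> (\<Sum>i<m. \<bar>sc k i\<bar>)\<^sup>2" using low by (intro power_mono) auto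
    also have "\<dots> \<le> R k * m"
      using sum_squared_le_sum_of_squares[of "\<lambda>i. \<bar>sc k i\<bar>" "{..<m}"] by (simp add: R_def)
    finally have "(49/64 * m) * m \<le> R k * m" by (simp add: power2_eq_square)
    then have R: "49/64 * m \<le> R k" using \<open>0 < m\<close> by simp
    have "real_of_int (\<Sum>i<m. \<bar>k i\<bar>) = 8 * (\<Sum>i<m. \<bar>sc k i\<bar>)"
      by (simp add: sc_def sum_distrib_left)
    also have "\<dots> \<le> real_of_int (int (9 * m))" using up by simp
    finally have sumk: "(\<Sum>i<m. \<bar>k i\<bar>) \<le> int (9 * m)" by linarith
    have "k \<in> {..<m} \<rightarrow>\<^sub>E {- int (9 * m)..int (9 * m)}"
    proof (rule PiE_I)
      fix i assume "i \<in> {..<m}"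
      then have "\<bar>k i\<bar> \<le> (\<Sum>i<m. \<bar>k i\<bar>)" by (intro member_le_sum) auto
      with sumk show "k i \<in> {- int (9 * m)..int (9 * m)}" by auto
    qed (simp add: k_def)
    then have "k \<in> l1_grid m (9 * m)" using sumk by (simp add: l1_grid_def)
    moreover have "0 < R k" using \<open>0 < m\<close> by (intro less_le_trans[OF _ R]) simp
    ultimately have "k \<in> F" by (simp add: F_def)
    then have "R k * T / 4 < q (sc k) x" and "N x < 4 * m * T"
      using \<open>x \<in> G\<close> by (auto simp: G_def B1_def B2_def)
    moreover have "(49/64 * m) * T \<le> R k * T" using R \<open>0 < T\<close> by (intro mult_right_mono) auto
    then have "49/64 * (m * T) \<le> R k * T" by (simp add: mult.assoc)
    moreover have "N x < 4 * (m * T)" using \<open>N x < 4 * m * T\<close> by (simp add: mult.assoc)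
    \<comment> \<open>The lower tail contributes 49/64 * 1/4 = 49/256, and rounding loses 4/256 by
      the trace bound; the remaining 45/256 exceeds 1/8.\<close>
    ultimately have "(49/256) * (m * T) \<le> q v x + (m * T) / 64" using qk by linarith
    moreover have "0 \<le> m * T" using \<open>0 < T\<close> by simp
    ultimately show ?thesis by linarith
  qed
  ultimately show ?thesis unfolding q_def by blast
qed

end

section \<open>Transfer to product samples and image measures\<close>

lemma indep_vars_PiM_pairs:
  fixes f :: "'j \<Rightarrow> 'a \<Rightarrow> real" and I :: "'i set"
  assumes N: "prob_space N" and I: "finite I" "finite J"
    and indep: "prob_space.indep_vars N (\<lambda>_. borel) f J"
  shows "prob_space.indep_vars (PiM I (\<lambda>_. N)) (\<lambda>_. borel) (\<lambda>(i, j) S. f j (S i)) (I \<times> J)"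
proof (cases "I = {} \<or> J = {}")
  case True
  interpret P: prob_space "PiM I (\<lambda>_. N)" using N by (intro prob_space_PiM)
  show ?thesis using True by (auto simp: P.indep_vars_def2 P.indep_sets_def)
next
  case False
  interpret N: prob_space N by fact
  interpret P: product_prob_space "\<lambda>_. N" I by unfold_locales
  interpret P: finite_product_prob_space "\<lambda>_. N" I by unfold_locales (rule I)
  have [measurable]: "f j \<in> borel_measurable N" if "j \<in> J" for j
    using indep that by (simp add: N.indep_vars_def)
  have fj: "(\<lambda>S. f j (S i)) \<in> borel_measurable (PiM I (\<lambda>_. N))" if "i \<in> I" "j \<in> J" for i j
    using that by measurable
  show ?thesis
  proof (subst P.indep_vars_finite[where E = "\<lambda>_. sets borel"], goal_cases)
    case 8
    show ?case
    proof safe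
      fix A :: "'i \<times> 'j \<Rightarrow> real set" assume A: "A \<in> I \<times> J \<rightarrow> sets borel"
      let ?X = "\<lambda>(i, j) S. f j (S i)"
      \<comment> \<open>\<open>B i\<close> gathers all conditions on the \<open>i\<close>-th sample
        point, so the joint event is a box: the product measure factors over \<open>i\<close>, and
        independence of the \<open>f j\<close> factors each side over \<open>j\<close>.\<close>
      define B where "B i = (\<Inter>j\<in>J. f j -` A (i, j) \<inter> space N)" for i
      have B: "B i \<in> sets N" if "i \<in> I" for i
        unfolding B_def using False I A that
        by (intro sets.finite_INT) (auto intro!: measurable_sets[of _ _ borel])
      have "(\<Inter>p\<in>I \<times> J. ?X p -` A p \<inter> space (PiM I (\<lambda>_. N))) = Pi\<^sub>E I B"
      proof (intro equalityI subsetI)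
        fix S assume "S \<in> Pi\<^sub>E I B"
        then show "S \<in> (\<Inter>p\<in>I \<times> J. ?X p -` A p \<inter> space (PiM I (\<lambda>_. N)))"
          using False by (auto simp: B_def space_PiM PiE_iff)
      next
        fix S assume S: "S \<in> (\<Inter>p\<in>I \<times> J. ?X p -` A p \<inter> space (PiM I (\<lambda>_. N)))"
        then have *: "S \<in> ?X p -` A p \<inter> space (PiM I (\<lambda>_. N))" if "p \<in> I \<times> J" for p
          using that by (rule INT_D)
        have "f j (S i) \<in> A (i, j)" if "i \<in> I" "j \<in> J" for i j
          using *[of "(i, j)"] that by simp
        moreover have "S \<in> space (PiM I (\<lambda>_. N))" using * False by auto
        ultimately show "S \<in> Pi\<^sub>E I B" by (auto simp: B_def space_PiM PiE_iff)
      qed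
      then have "P.prob (\<Inter>p\<in>I \<times> J. ?X p -` A p \<inter> space (PiM I (\<lambda>_. N))) = (\<Prod>i\<in>I. N.prob (B i))"
        using B by (simp add: P.prob_times)
      also have "\<dots> = (\<Prod>i\<in>I. \<Prod>j\<in>J. N.prob (f j -` A (i, j) \<inter> space N))"
        unfolding B_def using False I A by (intro prod.cong N.indep_varsD_finite[OF indep]) auto
      also have "\<dots> = (\<Prod>p\<in>I \<times> J. N.prob (f (snd p) -` A p \<inter> space N))"
        by (simp add: prod.cartesian_product case_prod_unfold)
      also have "\<dots> = (\<Prod>p\<in>I \<times> J. P.prob (?X p -` A p \<inter> space (PiM I (\<lambda>_. N))))"
      proof (intro prod.cong refl)
        fix p assume "p \<in> I \<times> J"
        then obtain i j where p: "p = (i, j)" "i \<in> I" "j \<in> J" by auto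
        then have S: "f j -` A (i, j) \<inter> space N \<in> sets N"
          using A by (intro measurable_sets[of _ _ borel]) auto
        have "N.prob (f j -` A (i, j) \<inter> space N)
            = measure (distr (PiM I (\<lambda>_. N)) N (\<lambda>S. S i)) (f j -` A (i, j) \<inter> space N)"
          using p N by (subst distr_PiM_component) auto
        also have "\<dots> = P.prob ((\<lambda>S. S i) -` (f j -` A (i, j) \<inter> space N) \<inter> space (PiM I (\<lambda>_. N)))"
          using S p by (intro measure_distr) auto
        also have "(\<lambda>S. S i) -` (f j -` A (i, j) \<inter> space N) \<inter> space (PiM I (\<lambda>_. N))
            = ?X p -` A p \<inter> space (PiM I (\<lambda>_. N))"
          using p by (auto simp: space_PiM PiE_iff)
        finally show "N.prob (f (snd p) -` A p \<inter> space N) = P.prob (?X p -` A p \<inter> space (PiM I (\<lambda>_. N)))"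
          using p by simp
      qed
      finally show "P.prob (\<Inter>p\<in>I \<times> J. ?X p -` A p \<inter> space (PiM I (\<lambda>_. N)))
          = (\<Prod>p\<in>I \<times> J. P.prob (?X p -` A p \<inter> space (PiM I (\<lambda>_. N))))" .
    qed
  qed (use False I fj in \<open>auto simp: Int_stable_def sets.sigma_sets_eq[of borel, simplified]\<close>)
qed

lemma subgaussian_rel_distr:
  assumes [measurable]: "f \<in> measurable M N" and "subgaussian_rel (distr M N f) \<rho> Z"
  shows "subgaussian_rel M \<rho> (\<lambda>x. Z (f x))"
proof -
  have [measurable]: "Z \<in> borel_measurable N" using assms(2) by (simp add: subgaussian_rel_def)
  show ?thesis
    using assms(2) unfolding subgaussian_rel_def
    by (simp add: nn_integral_distr integral_distr integrable_distr_eq)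
qed

text \<open>Independence is a property of the joint law, which is the same for \<open>X i\<close>
  under the image measure and for the composition with \<open>f\<close> under
  \<open>M\<close>.\<close>

lemma indep_vars_distr:
  assumes "prob_space M" and f[measurable]: "f \<in> measurable M N"
    and indep: "prob_space.indep_vars (distr M N f) M' X I"
  shows "prob_space.indep_vars M M' (\<lambda>i x. X i (f x)) I"
proof (cases "I = {}")
  case True
  interpret prob_space M by fact
  show ?thesis using True by (auto simp: indep_vars_def2 indep_sets_def)
next
  case False
  interpret M: prob_space M by fact
  interpret N: prob_space "distr M N f" by (rule M.prob_space_distr) fact
  have X[measurable]: "X i \<in> measurable N (M' i)" if "i \<in> I" for i
    using indep that by (simp add: N.indep_vars_def)
  have "distr M (PiM I M') (\<lambda>x. \<lambda>i\<in>I. X i (f x))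
      = distr (distr M N f) (PiM I M') (\<lambda>x. \<lambda>i\<in>I. X i x)"
    by (subst distr_distr) (auto simp: comp_def intro!: measurable_restrict)
  also have "\<dots> = (\<Pi>\<^sub>M i\<in>I. distr (distr M N f) (M' i) (X i))"
    using indep X by (subst (asm) N.indep_vars_iff_distr_eq_PiM'[OF False]) auto
  also have "\<dots> = (\<Pi>\<^sub>M i\<in>I. distr M (M' i) (\<lambda>x. X i (f x)))"
    using X by (intro PiM_cong refl) (simp add: distr_distr comp_def)
  finally show ?thesis
    using X by (subst M.indep_vars_iff_distr_eq_PiM'[OF False]) auto
qed

section \<open>Effective dimension\<close>

text \<open>Clip every eigenvalue at \<open>g\<close>; the clipped values sum to at least g k, and a
  common factor brings the sum down to g k. As \<open>tail\<close> speaks of all index sets of the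
  given size, the eigenvalues can stay unsorted.\<close>

lemma effective_dimension_weights:
  fixes lam :: "nat \<Rightarrow> real" and g :: real and d k :: nat
  assumes lam: "\<And>j. j < d \<Longrightarrow> 0 \<le> lam j" and "0 < g" "k \<le> d"
    and tail: "\<And>J. J \<subseteq> {..<d} \<Longrightarrow> card J = d - k \<Longrightarrow> g * k < (\<Sum>j\<in>J. lam j)"
  shows "\<exists>\<theta>. (\<forall>j<d. 0 \<le> \<theta> j \<and> \<theta> j \<le> 1 \<and> \<theta> j * lam j \<le> g) \<and> (\<Sum>j<d. \<theta> j * lam j) = g * k"
proof (cases "k = 0")
  case True
  then show ?thesis using \<open>0 < g\<close> by (intro exI[of _ "\<lambda>_. 0"]) simp
next
  case False
  define \<mu> where "\<mu> j = min (lam j) g" for j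
  have \<mu>: "0 \<le> \<mu> j" "\<mu> j \<le> g" "\<mu> j \<le> lam j" if "j < d" for j
    using lam[OF that] \<open>0 < g\<close> by (auto simp: \<mu>_def)
  define B where "B = {j. j < d \<and> g \<le> lam j}"
  have B: "finite B" "B \<subseteq> {..<d}" by (auto simp: B_def)
  have big: "g * k \<le> (\<Sum>j<d. \<mu> j)"
  \<comment> \<open>If \<open>k\<close> values reach \<open>g\<close>, their clipped parts alone sum
    to g k. Otherwise discard \<open>k\<close> indices including all of the large ones: the other d
    - k values are not clipped and \<open>tail\<close> applies.\<close>
  proof (cases "k \<le> card B")
    case True
    then have "g * k \<le> (\<Sum>j\<in>B. g)" using \<open>0 < g\<close> by simp
    also have "\<dots> = (\<Sum>j\<in>B. \<mu> j)" by (intro sum.cong) (auto simp: B_def \<mu>_def)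
    also have "\<dots> \<le> (\<Sum>j<d. \<mu> j)" using B \<mu> by (intro sum_mono2) auto
    finally show ?thesis .
  next
    case False
    then obtain B' where B': "B \<subseteq> B'" "B' \<subseteq> {..<d}" "card B' = k"
      using exists_subset_between[of B k "{..<d}"] B \<open>k \<le> d\<close> by auto
    have "card ({..<d} - B') = d - k"
      using B' by (subst card_Diff_subset) (auto intro: finite_subset)
    then have "g * k < (\<Sum>j\<in>{..<d} - B'. lam j)" by (intro tail) auto
    also have "\<dots> = (\<Sum>j\<in>{..<d} - B'. \<mu> j)"
      using B' by (intro sum.cong) (auto simp: B_def \<mu>_def)
    also have "\<dots> \<le> (\<Sum>j<d. \<mu> j)" using \<mu> by (intro sum_mono2) auto
    finally show ?thesis by simp
  qed
  define T where "T = (\<Sum>j<d. \<mu> j)"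
  have "0 < g * k" using False \<open>0 < g\<close> by simp
  then have "0 < T" using big by (simp add: T_def)
  define c where "c = g * k / T"
  have c: "0 \<le> c" "c \<le> 1" using \<open>0 < g * k\<close> \<open>0 < T\<close> big by (auto simp: c_def T_def[symmetric] divide_le_eq)
  \<comment> \<open>Where \<open>lam j\<close> is 0 the quotient is 0 by convention and so is
    \<open>\<mu> j\<close>; hence the weighted eigenvalue is c times the clipped one in every
    case.\<close>
  define \<theta> where "\<theta> j = c * (\<mu> j / lam j)" for j
  have \<theta>lam: "\<theta> j * lam j = c * \<mu> j" if "j < d" for j
    using \<mu>[OF that] by (cases "lam j = 0") (auto simp: \<theta>_def)
  have "0 \<le> \<theta> j \<and> \<theta> j \<le> 1 \<and> \<theta> j * lam j \<le> g" if "j < d" for j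
  proof (intro conjI)
    have q: "0 \<le> \<mu> j / lam j" "\<mu> j / lam j \<le> 1"
      using \<mu>[OF that] lam[OF that] by (auto simp: divide_le_eq)
    then show "0 \<le> \<theta> j" unfolding \<theta>_def using c by (intro mult_nonneg_nonneg)
    show "\<theta> j \<le> 1" unfolding \<theta>_def using q c by (intro mult_le_one)
    have "c * \<mu> j \<le> 1 * g" using c \<mu>[OF that] by (intro mult_mono) auto
    then show "\<theta> j * lam j \<le> g" using \<theta>lam[OF that] by simp
  qed
  moreover have "(\<Sum>j<d. \<theta> j * lam j) = c * T"
    using \<theta>lam by (simp add: T_def sum_distrib_left)
  then have "(\<Sum>j<d. \<theta> j * lam j) = g * k" using \<open>0 < T\<close> by (simp add: c_def)
  ultimately show ?thesis by blast
qed

text \<open>Used in contraposed form: failure of \<open>limited\<close> bounds from below the tail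
  sum over every set of d - k basis vectors. The bijection \<open>e\<close> renumbers
  \<open>J\<close> as the definition of \<open>limited\<close> demands.\<close>

lemma limitedI_coordinates:
  fixes J :: "nat set"
  assumes orth: "\<And>i j. i < d \<Longrightarrow> j < d \<Longrightarrow> inner_d d (a i) (a j) = (if i = j then 1 else 0)"
    and int: "\<And>j. j < d \<Longrightarrow> integrable DX (\<lambda>x. (inner_d d (a j) x)\<^sup>2)"
    and J: "J \<subseteq> {..<d}" "card J = d - k" and "k \<le> d"
    and le: "(\<Sum>j\<in>J. \<integral>x. (inner_d d (a j) x)\<^sup>2 \<partial>DX) \<le> b"
  shows "limited d DX b k"
proof -
  have "finite J" using J by (auto intro: finite_subset)
  then obtain e where e: "bij_betw e {..<d - k} J"
    using ex_bij_betw_nat_finite[of J] J by (auto simp: atLeast0LessThan)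
  then have eJ: "e i \<in> J" if "i < d - k" for i using that by (auto simp: bij_betw_def)
  have ed: "e i < d" if "i < d - k" for i using eJ[OF that] J by auto
  have inj: "e i = e j \<longleftrightarrow> i = j" if "i < d - k" "j < d - k" for i j
    using e that by (auto simp: bij_betw_def inj_on_def)
  have "(\<integral>\<^sup>+x. ennreal (\<Sum>j<d - k. (inner_d d (a (e j)) x)\<^sup>2) \<partial>DX)
      = ennreal (\<integral>x. (\<Sum>j<d - k. (inner_d d (a (e j)) x)\<^sup>2) \<partial>DX)"
    using int ed by (intro nn_integral_eq_integral Bochner_Integration.integrable_sum)
      (auto intro!: AE_I2 sum_nonneg)
  also have "(\<integral>x. (\<Sum>j<d - k. (inner_d d (a (e j)) x)\<^sup>2) \<partial>DX)
      = (\<Sum>j<d - k. \<integral>x. (inner_d d (a (e j)) x)\<^sup>2 \<partial>DX)"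
    using int ed by (intro Bochner_Integration.integral_sum) auto
  also have "\<dots> = (\<Sum>j\<in>J. \<integral>x. (inner_d d (a j) x)\<^sup>2 \<partial>DX)"
    using sum.reindex_bij_betw[OF e] by simp
  finally have "(\<integral>\<^sup>+x. ennreal (\<Sum>j<d - k. (inner_d d (a (e j)) x)\<^sup>2) \<partial>DX) \<le> ennreal b"
    using le by (simp add: ennreal_leI)
  then show ?thesis
    unfolding limited_def using \<open>k \<le> d\<close> orth ed inj
    by (intro conjI exI[of _ "\<lambda>i. a (e i)"]) auto
qed


section \<open>The adversarial algorithm\<close>

lemma inner_d_minus: "inner_d d (\<lambda>i. - w i) x = - inner_d d w x"
  by (simp add: inner_d_def sum_negf)

lemma W_d_minus: "(\<lambda>i. - w i) \<in> W_d d \<longleftrightarrow> w \<in> W_d d"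
  by (simp add: W_d_def)

lemma open_inner_d_halfspace: "open {w. \<gamma> < y * inner_d d w x}"
proof -
  have "continuous_on UNIV (\<lambda>w. y * inner_d d w x)"
    unfolding inner_d_def by (intro continuous_intros continuous_on_product_coordinates)
  then show ?thesis by (intro open_Collect_less continuous_on_const)
qed

text \<open>As a sum of indicators the empirical loss is visibly measurable in \<open>S\<close> and
  monotone in the set of violated constraints.\<close>

lemma emp_margin_loss_eq:
  "emp_margin_loss d \<gamma> w n S
    = (\<Sum>i<n. if snd (S i) * inner_d d w (fst (S i)) \<le> \<gamma> then 1 else 0) / real n"
proof -
  have "(\<Sum>i<n. if snd (S i) * inner_d d w (fst (S i)) \<le> \<gamma> then 1 else (0::real))
      = (\<Sum>i\<in>{i \<in> {..<n}. snd (S i) * inner_d d w (fst (S i)) \<le> \<gamma>}. 1)"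
    by (simp add: sum.If_cases Int_def)
  then show ?thesis by (simp add: emp_margin_loss_def)
qed

lemma emp_margin_loss_antimono:
  assumes "\<And>i. i < n \<Longrightarrow> \<gamma> < snd (S i) * inner_d d w (fst (S i)) \<Longrightarrow> \<gamma> < snd (S i) * inner_d d w' (fst (S i))"
  shows "emp_margin_loss d \<gamma> w' n S \<le> emp_margin_loss d \<gamma> w n S"
  unfolding emp_margin_loss_eq using assms
  by (intro divide_right_mono sum_mono) (auto simp: not_le[symmetric])

lemma measurable_label_inner_d:
  assumes D: "sets D = sets (space_X d \<Otimes>\<^sub>M labels)"
  shows "(\<lambda>p. snd p * inner_d d w (fst p)) \<in> borel_measurable D"
proof -
  have [measurable]: "inner_d d w \<in> borel_measurable (space_X d)"
    unfolding inner_d_def space_X_def by measurable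
  have [measurable]: "(\<lambda>y. y) \<in> borel_measurable labels"
    unfolding labels_def by simp
  have "(\<lambda>p. snd p * inner_d d w (fst p)) \<in> borel_measurable (space_X d \<Otimes>\<^sub>M labels)"
    by measurable
  then show ?thesis using measurable_cong_sets[OF D refl] by blast
qed

lemma loss0_minus:
  assumes "prob_space D" and D: "sets D = sets (space_X d \<Otimes>\<^sub>M labels)"
  shows "1 \<le> loss0 d D w + loss0 d D (\<lambda>i. - w i)"
proof -
  interpret D: prob_space D by fact
  note [measurable] = measurable_label_inner_d[OF D]
  have "1 = measure D ({p \<in> space D. snd p * inner_d d w (fst p) \<le> 0}
      \<union> {p \<in> space D. snd p * inner_d d (\<lambda>i. - w i) (fst p) \<le> 0})"
    by (subst D.prob_space[symmetric], rule arg_cong[where f = "measure D"]) (auto simp: inner_d_minus)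
  also have "\<dots> \<le> loss0 d D w + loss0 d D (\<lambda>i. - w i)"
    unfolding loss0_def by (rule measure_Un_le) measurable
  finally show ?thesis .
qed

text \<open>In \<^const>\<open>learn_loss\<close> a non-measurable failure event would have measure 0 and so would not count
  as a failure. The adversary therefore chooses, by least index, from a countable set that is
  dense both in the unit ball and in its part \<open>H\<close> of loss at least \<open>1/2\<close>; density suffices because
  the constraints with margin larger than \<open>\<gamma>\<close> are open.\<close>

lemma adversarial_MEM:
  fixes D :: "((nat \<Rightarrow> real) \<times> real) measure"
  assumes "prob_space D" and D: "sets D = sets (space_X d \<Otimes>\<^sub>M labels)" and "0 < \<gamma>"
    and G: "G \<in> sets (PiM {..<2 * n} (\<lambda>_. D))" "1 / 2 < measure (PiM {..<2 * n} (\<lambda>_. D)) G"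
    and split: "\<And>S. S \<in> G \<Longrightarrow> \<exists>w\<in>W_d d.
      (\<forall>i<n. \<gamma> < snd (S i) * inner_d d w (fst (S i))) \<and>
      (\<forall>i<n. \<gamma> < - (snd (S (n + i)) * inner_d d w (fst (S (n + i)))))"
  shows "\<exists>A. is_MEM d A \<and> 1 / 2 \<le> learn_loss d D (A \<gamma>) n (1 / 4)"
proof -
  interpret D: prob_space D by fact
  define H where "H = {w \<in> W_d d. 1 / 2 \<le> loss0 d D w}"
  obtain QH where QH: "countable QH" "QH \<subseteq> H" "H \<subseteq> closure QH" by (rule separable)
  obtain QW where QW: "countable QW" "QW \<subseteq> W_d d" "W_d d \<subseteq> closure QW" by (rule separable)
  \<comment> \<open>Finitely many strict margin constraints cut out an open set, so a point of the
    closure of \<open>Q\<close> can be replaced by a point of \<open>Q\<close> that keeps every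
    constraint already met.\<close>
  have dense: "\<exists>q\<in>Q. \<forall>i<n'. \<gamma>' < snd (S i) * inner_d d w (fst (S i)) \<longrightarrow> \<gamma>' < snd (S i) * inner_d d q (fst (S i))"
    if "T \<subseteq> closure Q" "w \<in> T" for T Q w n' \<gamma>' and S :: "nat \<Rightarrow> (nat \<Rightarrow> real) \<times> real"
  proof -
    let ?I = "{i. i < n' \<and> \<gamma>' < snd (S i) * inner_d d w (fst (S i))}"
    let ?U = "\<Inter>i\<in>?I. {w. \<gamma>' < snd (S i) * inner_d d w (fst (S i))}"
    have "open ?U" by (intro open_INT ballI open_inner_d_halfspace) simp
    moreover have "w \<in> ?U \<inter> closure Q" using that by auto
    then have "?U \<inter> closure Q \<noteq> {}" by blast
    ultimately have "?U \<inter> Q \<noteq> {}" using open_Int_closure_eq_empty by blast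
    then show ?thesis by blast
  qed
  define Q where "Q = QH \<union> QW"
  have "(\<lambda>_. 0) \<in> W_d d" by (simp add: W_d_def)
  then have "QW \<noteq> {}" using QW(3) by auto
  then have Q: "countable Q" "Q \<noteq> {}" "Q \<subseteq> W_d d"
    using QH QW by (auto simp: Q_def H_def)
  define e where "e = from_nat_into Q"
  have e_Q: "e l \<in> Q" for l using Q(2) by (simp add: e_def from_nat_into)
  have e_surj: "\<exists>l. e l = q" if "q \<in> Q" for q
    unfolding e_def using from_nat_into_surj[OF Q(1) that] .
  have Q_all: "(\<forall>q\<in>Q. R q) \<longleftrightarrow> (\<forall>k. R (e k))" for R
    using e_Q e_surj by blast
  have QH_ex: "(\<exists>q\<in>QH. R q) \<longleftrightarrow> (\<exists>k. e k \<in> QH \<and> R (e k))" for R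
    using e_surj unfolding Q_def by blast
  define fits where "fits \<gamma>' n' S q \<longleftrightarrow> (\<forall>i<n'. \<gamma>' < snd (S i) * inner_d d q (fst (S i)))"
    for \<gamma>' n' q and S :: "nat \<Rightarrow> (nat \<Rightarrow> real) \<times> real"
  \<comment> \<open>An index is acceptable if its vector minimizes the empirical loss within
    \<open>Q\<close> and lies in \<open>QH\<close> whenever some member of \<open>QH\<close> meets
    all margin constraints. Such a member has no empirical error, so the two demands are
    compatible.\<close>
  define P where "P \<gamma>' n' S l \<longleftrightarrow> (\<forall>q\<in>Q. emp_margin_loss d \<gamma>' (e l) n' S \<le> emp_margin_loss d \<gamma>' q n' S)
    \<and> ((\<exists>q\<in>QH. fits \<gamma>' n' S q) \<longrightarrow> e l \<in> QH)" for \<gamma>' n' S l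
  define A :: "real \<Rightarrow> alg" where "A \<gamma>' n' S = e (LEAST l. P \<gamma>' n' S l)" for \<gamma>' n' S
  have fits_min: "emp_margin_loss d \<gamma>' q n' S \<le> emp_margin_loss d \<gamma>' w n' S"
    if "fits \<gamma>' n' S q" for \<gamma>' n' S q w
    using that by (intro emp_margin_loss_antimono) (simp add: fits_def)
  \<comment> \<open>Density lifts minimality from \<open>Q\<close> to the whole unit ball.\<close>
  have approx: "\<exists>q\<in>QW. emp_margin_loss d \<gamma>' q n' S \<le> emp_margin_loss d \<gamma>' w n' S"
    if "w \<in> W_d d" for \<gamma>' n' S w
  proof -
    obtain q where "q \<in> QW" "\<forall>i<n'. \<gamma>' < snd (S i) * inner_d d w (fst (S i)) \<longrightarrow>
        \<gamma>' < snd (S i) * inner_d d q (fst (S i))"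
      using dense[OF QW(3) \<open>w \<in> W_d d\<close>] by blast
    then show ?thesis by (intro bexI[of _ q] emp_margin_loss_antimono) simp_all
  qed
  have P_ex: "\<exists>l. P \<gamma>' n' S l" for \<gamma>' n' S
  proof (cases "\<exists>q\<in>QH. fits \<gamma>' n' S q")
    case True
    then obtain q where q: "q \<in> QH" "fits \<gamma>' n' S q" by blast
    then obtain l where "e l = q" using e_surj[of q] by (auto simp: Q_def)
    then have "P \<gamma>' n' S l" using q fits_min by (auto simp: P_def)
    then show ?thesis by blast
  next
    case False
    let ?L = "\<lambda>q. emp_margin_loss d \<gamma>' q n' S"
    \<comment> \<open>The empirical loss takes finitely many values, so its minimum over
      \<open>Q\<close> is attained.\<close>
    have "?L ` Q \<subseteq> (\<lambda>c. real c / real n') ` {..n'}"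
    proof (intro image_subsetI)
      fix q
      have "card {i \<in> {..<n'}. snd (S i) * inner_d d q (fst (S i)) \<le> \<gamma>'} \<le> card {..<n'}"
        by (intro card_mono) auto
      then show "?L q \<in> (\<lambda>c. real c / real n') ` {..n'}"
        by (auto simp: emp_margin_loss_def)
    qed
    then have fin: "finite (?L ` Q)" by (rule finite_subset) auto
    then have "Min (?L ` Q) \<in> ?L ` Q" using Q(2) by (intro Min_in) auto
    then obtain q where "q \<in> Q" "?L q = Min (?L ` Q)" by auto
    moreover obtain l where "e l = q" using e_surj[OF \<open>q \<in> Q\<close>] by blast
    ultimately have "P \<gamma>' n' S l" using False fin by (auto simp: P_def)
    then show ?thesis by blast
  qed
  have P_A: "(\<forall>q\<in>Q. emp_margin_loss d \<gamma>' (A \<gamma>' n' S) n' S \<le> emp_margin_loss d \<gamma>' q n' S)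
    \<and> ((\<exists>q\<in>QH. fits \<gamma>' n' S q) \<longrightarrow> A \<gamma>' n' S \<in> QH)" for \<gamma>' n' S
    using LeastI_ex[OF P_ex[of \<gamma>' n' S]] unfolding A_def P_def .
  have "is_MEM d A"
    unfolding is_MEM_def
  proof (intro allI impI conjI ballI)
    fix \<gamma>' n' S w
    show "A \<gamma>' n' S \<in> W_d d" unfolding A_def using e_Q Q(3) by blast
    assume "w \<in> W_d d"
    then obtain q where "q \<in> QW" "emp_margin_loss d \<gamma>' q n' S \<le> emp_margin_loss d \<gamma>' w n' S"
      using approx by blast
    moreover have "emp_margin_loss d \<gamma>' (A \<gamma>' n' S) n' S \<le> emp_margin_loss d \<gamma>' q n' S"
      using P_A \<open>q \<in> QW\<close> by (simp add: Q_def)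
    ultimately show "emp_margin_loss d \<gamma>' (A \<gamma>' n' S) n' S \<le> emp_margin_loss d \<gamma>' w n' S" by linarith
  qed
  define Pn where "Pn = PiM {..<n} (\<lambda>_. D)"
  interpret Pn: prob_space Pn unfolding Pn_def by (intro prob_space_PiM) unfold_locales
  note label_meas = measurable_label_inner_d[OF D]
  have margin_meas[measurable]: "(\<lambda>S. snd (S i) * inner_d d q (fst (S i))) \<in> borel_measurable Pn"
    if "i \<in> {..<n}" for i q
    unfolding Pn_def
    using measurable_compose[OF measurable_component_singleton[OF that, of "\<lambda>_. D"] label_meas[of q]] .
  have fits_meas[measurable]: "Measurable.pred Pn (\<lambda>S. fits \<gamma> n S q)" for q
  proof -
    have "Measurable.pred Pn (\<lambda>S. \<forall>i\<in>{..<n}. \<gamma> < snd (S i) * inner_d d q (fst (S i)))"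
      by measurable
    then show ?thesis by (simp add: fits_def Ball_def)
  qed
  have emp_meas[measurable]: "(\<lambda>S. emp_margin_loss d \<gamma> q n S) \<in> borel_measurable Pn" for q
    unfolding emp_margin_loss_eq using margin_meas by measurable
  have P_meas[measurable]: "Measurable.pred Pn (\<lambda>S. P \<gamma> n S l)" for l
  proof -
    have "Measurable.pred Pn (\<lambda>S. emp_margin_loss d \<gamma> (e l) n S \<le> emp_margin_loss d \<gamma> (e k) n S)" for k
      using borel_measurable_le[OF emp_meas emp_meas] by (simp add: pred_def)
    moreover have "Measurable.pred Pn (\<lambda>S. e k \<in> QH \<and> fits \<gamma> n S (e k))" for k
      by (cases "e k \<in> QH") simp_all
    then have "Measurable.pred Pn (\<lambda>S. (\<exists>k. e k \<in> QH \<and> fits \<gamma> n S (e k)) \<longrightarrow> e l \<in> QH)"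
      by (cases "e l \<in> QH") auto
    ultimately show ?thesis
      unfolding P_def Q_all QH_ex by (intro pred_intros_logic(3) pred_intros_countable(1))
  qed
  have loss_meas[measurable]: "(\<lambda>S. loss0 d D (A \<gamma> n S)) \<in> borel_measurable Pn"
    unfolding A_def by measurable
  define B where "B = {S \<in> space Pn. \<exists>q\<in>QH. fits \<gamma> n S q}"
  have B[measurable]: "B \<in> sets Pn" 
  proof -
    have "Measurable.pred Pn (\<lambda>S. e k \<in> QH \<and> fits \<gamma> n S (e k))" for k
      by (cases "e k \<in> QH") simp_all
    then have "Measurable.pred Pn (\<lambda>S. \<exists>k. e k \<in> QH \<and> fits \<gamma> n S (e k))"
      by (rule pred_intros_countable(2))
    then show ?thesis unfolding B_def QH_ex by (simp add: pred_def)
  qed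
  have B_loss: "1 / 2 \<le> loss0 d D (A \<gamma> n S)" if "S \<in> B" for S
    using that P_A[of \<gamma> n S] QH(2) by (auto simp: B_def H_def)
  have "1 / 4 < measure Pn B"
  proof -
    define P2 where "P2 = PiM {..<2 * n} (\<lambda>_. D)"
    interpret P2: prob_space P2 unfolding P2_def by (intro prob_space_PiM) unfold_locales
    \<comment> \<open>\<open>part f\<close> reads a sample of size \<open>n\<close> off one of size
      2 n along the injection \<open>f\<close>; its law is again the product measure.\<close>
    define part where "part f S = (\<lambda>i\<in>{..<n}. S (f i))" for f :: "nat \<Rightarrow> nat" and S :: "nat \<Rightarrow> (nat \<Rightarrow> real) \<times> real"
    have part: "part f \<in> measurable P2 Pn" "distr P2 Pn (part f) = Pn"
      if "inj_on f {..<n}" "f \<in> {..<n} \<rightarrow> {..<2 * n}" for f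
    proof -
      show "part f \<in> measurable P2 Pn"
        unfolding part_def[abs_def] P2_def Pn_def using that
        by (intro measurable_restrict measurable_component_singleton) auto
      show "distr P2 Pn (part f) = Pn"
        unfolding P2_def Pn_def part_def[abs_def] using that
        by (intro distr_PiM_reindex) (auto intro: D.prob_space_axioms)
    qed
    have part_prob: "P2.prob (part f -` B \<inter> space P2) = Pn.prob B"
      if "inj_on f {..<n}" "f \<in> {..<n} \<rightarrow> {..<2 * n}" for f
      using measure_distr[OF part(1)[OF that] B] part(2)[OF that] by simp
    have f1: "inj_on (\<lambda>i. i) {..<n}" "(\<lambda>i. i) \<in> {..<n} \<rightarrow> {..<2 * n}"
      and f2: "inj_on (\<lambda>i. n + i) {..<n}" "(\<lambda>i. n + i) \<in> {..<n} \<rightarrow> {..<2 * n}" by auto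
    have in_B: "part f S \<in> B"
      if f: "inj_on f {..<n}" "f \<in> {..<n} \<rightarrow> {..<2 * n}" and S: "S \<in> space P2" and "w \<in> H"
        and w: "\<And>i. i < n \<Longrightarrow> \<gamma> < snd (S (f i)) * inner_d d w (fst (S (f i)))" for f S w
    proof -
      have "part f S \<in> space Pn" using measurable_space[OF part(1)[OF f] S] .
      moreover have "\<exists>q\<in>QH. \<forall>i<n. \<gamma> < snd (part f S i) * inner_d d q (fst (part f S i))"
        using w dense[OF QH(3) \<open>w \<in> H\<close>, of n \<gamma> "part f S"] by (simp add: part_def)
      ultimately show ?thesis by (auto simp: B_def fits_def)
    qed
    \<comment> \<open>Whichever of w and - w has loss at least 1/2 puts the first or the second half
      into \<open>B\<close>. Both halves have the same law, so twice the probability of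
      \<open>B\<close> exceeds 1/2.\<close>
    have "G \<subseteq> (part (\<lambda>i. i) -` B \<inter> space P2) \<union> (part (\<lambda>i. n + i) -` B \<inter> space P2)"
    proof
      fix S assume "S \<in> G"
      then have S: "S \<in> space P2" using sets.sets_into_space[OF G(1)] by (auto simp: P2_def)
      obtain w where w: "w \<in> W_d d" "\<And>i. i < n \<Longrightarrow> \<gamma> < snd (S i) * inner_d d w (fst (S i))"
        "\<And>i. i < n \<Longrightarrow> \<gamma> < - (snd (S (n + i)) * inner_d d w (fst (S (n + i))))"
        using split[OF \<open>S \<in> G\<close>] by blast
      consider "1 / 2 \<le> loss0 d D w" | "1 / 2 \<le> loss0 d D (\<lambda>i. - w i)"
        using loss0_minus[OF \<open>prob_space D\<close> D, of w] by linarith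
      then show "S \<in> (part (\<lambda>i. i) -` B \<inter> space P2) \<union> (part (\<lambda>i. n + i) -` B \<inter> space P2)"
      proof cases
        case 1
        then have "w \<in> H" using w(1) by (simp add: H_def)
        then show ?thesis using in_B[OF f1 S] w(2) S by blast
      next
        case 2
        then have "(\<lambda>i. - w i) \<in> H" using w(1) by (simp add: H_def W_d_minus)
        then show ?thesis using in_B[OF f2 S] w(3) S by (simp add: inner_d_minus)
      qed
    qed
    then have "P2.prob G \<le> P2.prob ((part (\<lambda>i. i) -` B \<inter> space P2) \<union> (part (\<lambda>i. n + i) -` B \<inter> space P2))"
      using part(1)[OF f1] part(1)[OF f2]
      by (intro P2.finite_measure_mono sets.Un measurable_sets[OF _ B])
    also have "\<dots> \<le> Pn.prob B + Pn.prob B"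
      using part(1)[OF f1] part(1)[OF f2]
      by (subst (1) part_prob[OF f1, symmetric], subst (1) part_prob[OF f2, symmetric])
        (intro measure_Un_le measurable_sets[OF _ B])
    finally show ?thesis using G(2) by (simp add: P2_def)
  qed
  have "1 / 2 \<le> learn_loss d D (A \<gamma>) n (1 / 4)"
    unfolding learn_loss_def Pn_def[symmetric]
  proof (rule cInf_greatest)
    have "loss0 d D w < 2" for w
      unfolding loss0_def by (rule le_less_trans[OF D.prob_le_1]) simp
    then have none: "{S \<in> space Pn. 2 \<le> loss0 d D (A \<gamma> n S)} = {}" by (auto simp: not_le)
    \<comment> \<open>Losses are at most 1, so the level 2 is always admissible and the infimum is
      over a nonempty set.\<close>
    have "2 \<in> {\<epsilon>. 0 \<le> \<epsilon> \<and> Pn.prob {S \<in> space Pn. \<epsilon> \<le> loss0 d D (A \<gamma> n S)} \<le> 1 / 4}"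
      unfolding mem_Collect_eq none by simp
    then show "{\<epsilon>. 0 \<le> \<epsilon> \<and> Pn.prob {S \<in> space Pn. \<epsilon> \<le> loss0 d D (A \<gamma> n S)} \<le> 1 / 4} \<noteq> {}"
      by blast
  next
    fix \<epsilon> assume \<epsilon>: "\<epsilon> \<in> {\<epsilon>. 0 \<le> \<epsilon> \<and> Pn.prob {S \<in> space Pn. \<epsilon> \<le> loss0 d D (A \<gamma> n S)} \<le> 1 / 4}"
    show "1 / 2 \<le> \<epsilon>"
    proof (rule ccontr)
      assume "\<not> 1 / 2 \<le> \<epsilon>"
      then have "B \<subseteq> {S \<in> space Pn. \<epsilon> \<le> loss0 d D (A \<gamma> n S)}"
        using B_loss sets.sets_into_space[OF B] by force
      then have "Pn.prob B \<le> Pn.prob {S \<in> space Pn. \<epsilon> \<le> loss0 d D (A \<gamma> n S)}"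
        by (intro Pn.finite_measure_mono) measurable
      then show False using \<epsilon> \<open>1 / 4 < measure Pn B\<close> by simp
    qed
  qed
  with \<open>is_MEM d A\<close> show ?thesis by blast
qed

section \<open>The lower bound\<close>

lemma inner_d_lincomb:
  "inner_d d (\<lambda>i. \<Sum>j<m. c j * a j i) x = (\<Sum>j<m. c j * inner_d d (a j) x)"
  unfolding inner_d_def sum_distrib_left sum_distrib_right
  by (subst sum.swap) (simp add: mult.assoc)

lemma orthonormal_lincomb_in_W_d:
  assumes orth: "\<And>i j. i < d \<Longrightarrow> j < d \<Longrightarrow> inner_d d (a i) (a j) = (if i = j then 1 else 0)"
    and "(\<Sum>j<d. (c j)\<^sup>2) \<le> 1"
  shows "(\<lambda>i. \<Sum>j<d. c j * a j i) \<in> W_d d"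
proof -
  define w where "w = (\<lambda>i. \<Sum>j<d. c j * a j i)"
  have w_a: "inner_d d w x = (\<Sum>j<d. c j * inner_d d (a j) x)" for x
    by (simp add: w_def inner_d_lincomb)
  have "inner_d d w (a j) = c j" if "j < d" for j
  proof -
    have "inner_d d w (a j) = (\<Sum>l<d. if l = j then c l else 0)"
      unfolding w_a using orth that by (intro sum.cong) auto
    then show ?thesis using that by simp
  qed
  then have "inner_d d (a j) w = c j" if "j < d" for j
    using that by (simp add: inner_d_def mult.commute)
  then have "inner_d d w w = (\<Sum>j<d. (c j)\<^sup>2)"
    by (simp add: w_a power2_eq_square)
  then have "w \<in> W_d d"
    using assms(2) by (simp add: W_d_def inner_d_def power2_eq_square)
  then show ?thesis by (simp only: w_def)
qed

text \<open>On the good event for the damped coordinates, every signed convex combination of the 2 n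
  points has squared norm at least \<gamma>^2 k / (16 n), and
  \<open>minimal_point_separation\<close> yields \<open>w\<close> for any prescribed signs. As all
  signs are covered at once, the labels may depend on the points in any way.\<close>

lemma split_by_margin_event:
  fixes D :: "((nat \<Rightarrow> real) \<times> real) measure"
  assumes "0 < \<rho>" and "prob_space D" and D: "sets D = sets (space_X d \<Otimes>\<^sub>M labels)"
    and D_rho: "D_rho \<rho> d (marginal d D)" and "0 < \<gamma>"
    and k: "k_gamma d \<gamma> (marginal d D) = Suc k"
    and n: "16 * real n + 2 \<le> k / (1024 * \<rho> ^ 4)" "16 * real n < k"
  shows "\<exists>G\<in>sets (PiM {..<2 * n} (\<lambda>_. D)). 1 / 2 < measure (PiM {..<2 * n} (\<lambda>_. D)) G \<and>
    (\<forall>S\<in>G. \<exists>w\<in>W_d d. (\<forall>i<n. \<gamma> < snd (S i) * inner_d d w (fst (S i))) \<and>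
      (\<forall>i<n. \<gamma> < - (snd (S (n + i)) * inner_d d w (fst (S (n + i))))))"
proof -
  interpret D: prob_space D by fact
  have fst_meas[measurable]: "fst \<in> measurable D (space_X d)"
    using measurable_cong_sets[OF D refl, of "space_X d"] by simp
  define DX where "DX = marginal d D"
  have DX: "DX = distr D (space_X d) fst" by (simp add: DX_def marginal_def)
  obtain a where orth: "\<And>i j. i < d \<Longrightarrow> j < d \<Longrightarrow> inner_d d (a i) (a j) = (if i = j then 1 else 0)"
    and indep: "prob_space.indep_vars DX (\<lambda>_. borel) (\<lambda>i x. inner_d d (a i) x) {..<d}"
    and sub: "\<And>j. j < d \<Longrightarrow> subgaussian_rel DX \<rho> (\<lambda>x. inner_d d (a j) x)"
    using D_rho unfolding D_rho_def DX_def by blast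
  define f where "f j p = inner_d d (a j) (fst p)" for j and p :: "(nat \<Rightarrow> real) \<times> real"
  define lam where "lam j = (\<integral>x. (inner_d d (a j) x)\<^sup>2 \<partial>DX)" for j
  have f_sub: "subgaussian_rel D \<rho> (f j)" if "j < d" for j
    using subgaussian_rel_distr[OF fst_meas sub[OF that, unfolded DX]] by (simp add: f_def[abs_def])
  have inner_meas[measurable]: "inner_d d w \<in> borel_measurable (space_X d)" for w
    unfolding inner_d_def[abs_def] space_X_def by measurable
  have f_var: "(\<integral>p. (f j p)\<^sup>2 \<partial>D) = lam j" for j
    unfolding lam_def DX f_def by (simp add: integral_distr)
  have f_indep: "D.indep_vars (\<lambda>_. borel) f {..<d}"
    using indep_vars_distr[OF \<open>prob_space D\<close> fst_meas indep[unfolded DX]] by (simp add: f_def[abs_def])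

  have "k_gamma d \<gamma> DX \<le> d"
    unfolding k_gamma_def by (rule Least_le) (auto simp: limited_def)
  then have "k \<le> d" using k by (simp add: DX_def)
  \<comment> \<open>\<open>k\<close> lies one below the least admissible dimension, so
    \<open>limited\<close> fails at \<open>k\<close> itself.\<close>
  have not_limited: "\<not> limited d DX (\<gamma>\<^sup>2 * k) k"
    using not_less_Least[of k "\<lambda>k. limited d DX (\<gamma>\<^sup>2 * k) k"] k
    by (simp add: k_gamma_def DX_def)
  have tail: "\<gamma>\<^sup>2 * k < (\<Sum>j\<in>J. lam j)" if "J \<subseteq> {..<d}" "card J = d - k" for J
  proof (rule ccontr)
    assume "\<not> ?thesis"
    then have "limited d DX (\<gamma>\<^sup>2 * k) k"
      using sub \<open>k \<le> d\<close> that orth unfolding lam_def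
      by (intro limitedI_coordinates[of d a DX J k]) (auto simp: subgaussian_rel_def)
    with not_limited show False ..
  qed
  have "0 \<le> lam j" for j by (simp add: lam_def)
  then obtain \<theta> where \<theta>: "\<And>j. j < d \<Longrightarrow> 0 \<le> \<theta> j" "\<And>j. j < d \<Longrightarrow> \<theta> j \<le> 1"
    "\<And>j. j < d \<Longrightarrow> \<theta> j * lam j \<le> \<gamma>\<^sup>2" "(\<Sum>j<d. \<theta> j * lam j) = \<gamma>\<^sup>2 * k"
    using effective_dimension_weights[of d lam "\<gamma>\<^sup>2" k] tail \<open>0 < \<gamma>\<close> \<open>k \<le> d\<close> by auto

  define P where "P = PiM {..<2 * n} (\<lambda>_. D)"
  interpret P: prob_space P unfolding P_def by (intro prob_space_PiM) unfold_locales
  define Z where "Z i j S = f j (S i)" for i j and S :: "nat \<Rightarrow> (nat \<Rightarrow> real) \<times> real"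
  have Z_indep: "P.indep_vars (\<lambda>_. borel) (\<lambda>(i, j). Z i j) ({..<2 * n} \<times> {..<d})"
    using indep_vars_PiM_pairs[OF \<open>prob_space D\<close> _ _ f_indep, of "{..<2 * n}"]
    by (simp add: P_def Z_def[abs_def] case_prod_unfold)
  have comp: "(\<lambda>S. S i) \<in> measurable P D" "distr P D (\<lambda>S. S i) = D" if "i < 2 * n" for i
    using that distr_PiM_component[of "{..<2 * n}" "\<lambda>_. D" i] \<open>prob_space D\<close>
    by (auto simp: P_def)
  have Z_sub: "subgaussian_rel P \<rho> (Z i j)" if "i < 2 * n" "j < d" for i j
    using subgaussian_rel_distr[OF comp(1)[OF that(1)], of \<rho> "f j"] comp(2)[OF that(1)] f_sub[OF that(2)]
    by (simp add: Z_def[abs_def])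
  have Z_var: "P.expectation (\<lambda>S. (Z i j S)\<^sup>2) = lam j" if "i < 2 * n" "j < d" for i j
  proof -
    have "(\<integral>p. (f j p)\<^sup>2 \<partial>distr P D (\<lambda>S. S i)) = P.expectation (\<lambda>S. (Z i j S)\<^sup>2)"
      using comp(1)[OF that(1)] f_sub[OF that(2)]
      by (subst integral_distr) (auto simp: Z_def subgaussian_rel_def)
    then show ?thesis using comp(2)[OF that(1)] f_var by simp
  qed
  have "0 < real k" using n(2) by linarith
  then obtain G where G: "G \<in> sets P" "1 / 2 < P.prob G"
    and G_low: "\<And>S v. S \<in> G \<Longrightarrow> (\<Sum>i<2 * n. \<bar>v i\<bar>) = real (2 * n) \<Longrightarrow>
      real (2 * n) * (\<gamma>\<^sup>2 * k) / 8 \<le> (\<Sum>j<d. \<theta> j * (\<Sum>i<2 * n. v i * Z i j S)\<^sup>2)"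
    using P.random_matrix_good_event[OF \<open>0 < \<rho>\<close> Z_indep Z_sub Z_var, of \<theta> "\<gamma>\<^sup>2" "\<gamma>\<^sup>2 * k"]
      \<theta> \<open>0 < \<gamma>\<close> n(1) by auto
  have "\<exists>w\<in>W_d d. (\<forall>i<n. \<gamma> < snd (S i) * inner_d d w (fst (S i))) \<and>
      (\<forall>i<n. \<gamma> < - (snd (S (n + i)) * inner_d d w (fst (S (n + i)))))" if "S \<in> G" for S
  proof -
    \<comment> \<open>The signs are the labels, reversed on the second half, so that one margin
      condition expresses both halves of the split.\<close>
    define s where "s i = (if i < n then snd (S i) else - snd (S i))" for i
    have "S \<in> space P" using sets.sets_into_space[OF G(1)] that by blast
    then have "S i \<in> space D" if "i < 2 * n" for i
      using that by (auto simp: P_def space_PiM PiE_iff)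
    moreover have "space D = space (space_X d) \<times> {-1, 1}"
      using sets_eq_imp_space_eq[OF D] by (simp add: space_pair_measure labels_def)
    ultimately have s: "\<bar>s i\<bar> = 1" if "i < 2 * n" for i
      using that by (fastforce simp: s_def)
    define z where "z i j = s i * (sqrt (\<theta> j) * Z i j S)" for i j
    \<comment> \<open>For positive \<open>n\<close>, c^2 is the bound \<gamma>^2 k / (16 n) of the
      good event and exceeds \<gamma>^2 because 16 n < k. For n = 0 the simplex is empty and any
      value above \<open>\<gamma>\<close> serves.\<close>
    define c where "c = (if n = 0 then \<gamma> + 1 else \<gamma> * sqrt (k / (16 * n)))"
    have "\<gamma> < c"
    proof (cases "n = 0")
      case False
      then have "1 < sqrt (k / (16 * n))" using n(2) by (simp add: less_divide_eq)
      then show ?thesis using False \<open>0 < \<gamma>\<close> by (simp add: c_def)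
    qed (simp add: c_def)
    have "\<exists>\<omega>. (\<Sum>j<d. (\<omega> j)\<^sup>2) \<le> 1 \<and> (\<forall>i<2 * n. \<gamma> < (\<Sum>j<d. \<omega> j * z i j))"
    proof (rule minimal_point_separation[OF \<open>0 < \<gamma>\<close> \<open>\<gamma> < c\<close>])
      fix v :: "nat \<Rightarrow> real"
      assume v: "\<And>i. i < 2 * n \<Longrightarrow> 0 \<le> v i" "(\<Sum>i<2 * n. v i) = 1"
      then have "0 < n" by (cases "n = 0") auto
      \<comment> \<open>A simplex vector, signed and scaled to l1-norm 2 n, has the normalization of
        \<open>G_low\<close>.\<close>
      let ?v = "\<lambda>i. real (2 * n) * (v i * s i)"
      have "(\<Sum>i<2 * n. \<bar>?v i\<bar>) = (\<Sum>i<2 * n. real (2 * n) * v i)"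
        using v(1) s by (intro sum.cong) (auto simp: abs_mult)
      also have "\<dots> = real (2 * n)" using v(2) by (simp flip: sum_distrib_left)
      finally have "real (2 * n) * (\<gamma>\<^sup>2 * k) / 8 \<le> (\<Sum>j<d. \<theta> j * (\<Sum>i<2 * n. ?v i * Z i j S)\<^sup>2)"
        by (rule G_low[OF that])
      also have "\<dots> = (\<Sum>j<d. (real (2 * n))\<^sup>2 * (\<Sum>i<2 * n. v i * z i j)\<^sup>2)"
      proof (intro sum.cong refl)
        fix j assume "j \<in> {..<d}"
        have "(\<Sum>i<2 * n. v i * z i j) = sqrt (\<theta> j) * (\<Sum>i<2 * n. v i * s i * Z i j S)"
          by (simp add: z_def sum_distrib_left mult_ac)
        moreover have "(\<Sum>i<2 * n. ?v i * Z i j S) = real (2 * n) * (\<Sum>i<2 * n. v i * s i * Z i j S)"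
          by (simp add: sum_distrib_left mult_ac)
        ultimately show "\<theta> j * (\<Sum>i<2 * n. ?v i * Z i j S)\<^sup>2 = (real (2 * n))\<^sup>2 * (\<Sum>i<2 * n. v i * z i j)\<^sup>2"
          using \<theta>(1) \<open>j \<in> {..<d}\<close> by (simp add: power_mult_distrib)
      qed
      also have "\<dots> = (real (2 * n))\<^sup>2 * (\<Sum>j<d. (\<Sum>i<2 * n. v i * z i j)\<^sup>2)"
        by (simp add: sum_distrib_left)
      finally have "\<gamma>\<^sup>2 * k / (16 * n) \<le> (\<Sum>j<d. (\<Sum>i<2 * n. v i * z i j)\<^sup>2)"
        using \<open>0 < n\<close> by (simp add: field_simps power2_eq_square)
      then show "c\<^sup>2 \<le> (\<Sum>j<d. (\<Sum>i<2 * n. v i * z i j)\<^sup>2)"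
        using \<open>0 < n\<close> by (simp add: c_def power_mult_distrib)
    qed
    then obtain \<omega> where \<omega>: "(\<Sum>j<d. (\<omega> j)\<^sup>2) \<le> 1" "\<And>i. i < 2 * n \<Longrightarrow> \<gamma> < (\<Sum>j<d. \<omega> j * z i j)"
      by blast
    \<comment> \<open>The damping moves from the points into \<open>w\<close>: its inner product
      with an original point is that of \<open>\<omega>\<close> with the damped one, and weights at
      most 1 keep it in the unit ball.\<close>
    define w where "w = (\<lambda>i. \<Sum>j<d. (\<omega> j * sqrt (\<theta> j)) * a j i)"
    have "(\<Sum>j<d. (\<omega> j * sqrt (\<theta> j))\<^sup>2) \<le> (\<Sum>j<d. (\<omega> j)\<^sup>2)"
      using \<theta>(1,2) by (intro sum_mono) (simp add: power_mult_distrib mult_left_le)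
    then have "w \<in> W_d d"
      unfolding w_def using \<omega>(1) orth by (intro orthonormal_lincomb_in_W_d) auto
    have margin: "\<gamma> < s i * inner_d d w (fst (S i))" if "i < 2 * n" for i
    proof -
      have "(\<Sum>j<d. \<omega> j * z i j) = s i * inner_d d w (fst (S i))"
        unfolding w_def inner_d_lincomb by (simp add: z_def Z_def f_def sum_distrib_left mult_ac)
      then show ?thesis using \<omega>(2)[OF that] by simp
    qed
    show ?thesis
    proof (intro bexI[OF _ \<open>w \<in> W_d d\<close>] conjI allI impI)
      fix i assume "i < n"
      then show "\<gamma> < snd (S i) * inner_d d w (fst (S i))" using margin[of i] by (simp add: s_def)
      show "\<gamma> < - (snd (S (n + i)) * inner_d d w (fst (S (n + i))))"
        using margin[of "n + i"] \<open>i < n\<close> by (simp add: s_def)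
    qed
  qed
  then show ?thesis using G unfolding P_def by blast
qed

theorem mainTheorem17:
  fixes \<rho> :: real
  assumes "\<rho> > 0"
  shows "\<exists>\<beta>>0. \<exists>C\<ge>0. \<forall>(d::nat) (D :: ((nat \<Rightarrow> real) \<times> real) measure) (\<gamma>::real) (\<epsilon>::real).
           prob_space D \<and> sets D = sets (space_X d \<Otimes>\<^sub>M labels) \<and>
           D_rho \<rho> d (marginal d D) \<and> \<gamma> > 0 \<and> \<epsilon> < 1/2 - opt_margin_loss d \<gamma> D \<longrightarrow>
           (\<forall>m. sample_complexity d \<epsilon> \<gamma> D (1/4) = enat m \<longrightarrow>
                 real m \<ge> \<beta> * real (k_gamma d \<gamma> (marginal d D)) - C)"
proof -
  \<comment> \<open>After multiplication by 16 the two terms are the coefficients of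
    \<open>k\<close> in the two size conditions of \<open>split_by_margin_event\<close>.\<close>
  define \<beta> where "\<beta> = min (1 / (16384 * \<rho> ^ 4)) (1 / 16)"
  have "0 < \<beta>" using assms by (simp add: \<beta>_def)
  have \<beta>: "16 * \<beta> \<le> 1 / (1024 * \<rho> ^ 4)" "16 * \<beta> \<le> 1"
  proof -
    have "16 * (1 / (16384 * \<rho> ^ 4)) = 1 / (1024 * \<rho> ^ 4)" by simp
    moreover have "\<beta> \<le> 1 / (16384 * \<rho> ^ 4)" "\<beta> \<le> 1 / 16" by (auto simp: \<beta>_def)
    ultimately show "16 * \<beta> \<le> 1 / (1024 * \<rho> ^ 4)" "16 * \<beta> \<le> 1" by linarith+
  qed
  have "\<beta> * real (k_gamma d \<gamma> (marginal d D)) - 1 \<le> real m"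
    if "prob_space D" and D: "sets D = sets (space_X d \<Otimes>\<^sub>M labels)"
      and D_rho: "D_rho \<rho> d (marginal d D)" and "0 < \<gamma>"
      and \<epsilon>: "\<epsilon> < 1 / 2 - opt_margin_loss d \<gamma> D"
      and m: "sample_complexity d \<epsilon> \<gamma> D (1 / 4) = enat m"
    for d D \<gamma> \<epsilon> m
  proof (rule ccontr)
    assume "\<not> ?thesis"
    then have less: "real m < \<beta> * real (k_gamma d \<gamma> (marginal d D)) - 1" by simp
    \<comment> \<open>If \<open>k_gamma\<close> were 0, the right-hand side would be -1, below any
      sample size.\<close>
    then obtain k where k: "k_gamma d \<gamma> (marginal d D) = Suc k"
      by (cases "k_gamma d \<gamma> (marginal d D)") auto
    \<comment> \<open>With C = 1 the scaled inequality has a slack of 16, which covers both the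
      passage from k + 1 to k, costing 16 \<beta> <= 1, and the additive 2.\<close>
    have "16 * real m < (16 * \<beta>) * k + 16 * \<beta> - 16"
      using less unfolding k by (simp add: algebra_simps)
    moreover have "(16 * \<beta>) * k \<le> 1 / (1024 * \<rho> ^ 4) * k" "(16 * \<beta>) * k \<le> (1::real) * real k"
      using \<beta> by (intro mult_right_mono; simp)+
    ultimately have "16 * real m + 2 \<le> k / (1024 * \<rho> ^ 4)" "16 * real m < k"
      using \<beta>(2) by simp_all
    from split_by_margin_event[OF assms \<open>prob_space D\<close> D D_rho \<open>0 < \<gamma>\<close> k this]
    obtain G where G: "G \<in> sets (PiM {..<2 * m} (\<lambda>_. D))" "1 / 2 < measure (PiM {..<2 * m} (\<lambda>_. D)) G"
      and split: "\<forall>S\<in>G. \<exists>w\<in>W_d d. (\<forall>i<m. \<gamma> < snd (S i) * inner_d d w (fst (S i))) \<and>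
        (\<forall>i<m. \<gamma> < - (snd (S (m + i)) * inner_d d w (fst (S (m + i)))))"
      by (elim bexE conjE) (rule that)
    have "\<exists>A. is_MEM d A \<and> 1 / 2 \<le> learn_loss d D (A \<gamma>) m (1 / 4)"
      by (rule adversarial_MEM[OF \<open>prob_space D\<close> D \<open>0 < \<gamma>\<close> G]) (rule bspec[OF split])
    then obtain A where A: "is_MEM d A" "1 / 2 \<le> learn_loss d D (A \<gamma>) m (1 / 4)"
      by blast
    let ?X = "{enat m0 | m0. \<forall>A. is_MEM d A \<longrightarrow>
      (\<forall>n\<ge>m0. learn_loss d D (A \<gamma>) n (1 / 4) - opt_margin_loss d \<gamma> D \<le> \<epsilon>)}"
    \<comment> \<open>A finite infimum in \<open>enat\<close> is attained, so \<open>m\<close> is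
      itself an admissible threshold and the adversary for samples of size exactly \<open>m\<close>
      contradicts it.\<close>
    have "enat m \<in> X" if "Inf X = enat m" for X
    proof -
      have "X \<noteq> {}" using that by (auto simp: Inf_enat_def)
      then have "(LEAST x. x \<in> X) \<in> X" by (auto intro: LeastI)
      then show ?thesis using that \<open>X \<noteq> {}\<close> by (simp add: Inf_enat_def)
    qed
    then have "enat m \<in> ?X" using m unfolding sample_complexity_def by blast
    then have "learn_loss d D (A \<gamma>) m (1 / 4) - opt_margin_loss d \<gamma> D \<le> \<epsilon>" using A(1) by auto
    then show False using A(2) \<epsilon> by simp
  qed
  note bound = this
  show ?thesis
    by (rule exI[of _ \<beta>], rule conjI, fact, rule exI[of _ 1], rule conjI, simp,
        intro allI impI, elim conjE) (rule bound)
qed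

end
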